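(* Let $G$ be an amenable (discrete) group and let $A\subseteq G$ be a set with positive upper Banach density, i.e. $\mathsf{BD}(A)>0$. Then there is a Bohr$_0$ set $B\subseteq G$ such that $\mathsf{BD}(B\setminus AA^{-1})=0$, where $AA^{-1}=\{ab^{-1}: a,b\in A\}$.
   Context: $G$ is a discrete group, of arbitrary cardinality and not assumed abelian. Let $\mathfrak{M}_\ell(G)$ denote the collection of left-invariant finitely additive probability measures on the Boolean algebra of all subsets of $G$; that is, finitely additive functions $\mu\colon \mathcal{P}(G)\to[0,1]$ with $\mu(G)=1$ and $\mu(gX)=\mu(X)$ for all $g\in G$ and $X\subseteq G$. The group $G$ is amenable if $\mathfrak{M}_\ell(G)\neq\emptyset$. If $G$ is amenable, the upper Banach density of a set $X\subseteq G$ is defined as $\mathsf{BD}(X)=\sup\{\mu(X):\mu\in\mathfrak{M}_\ell(G)\}$. A subset $B\subseteq G$ is a Bohr$_0$ set if it contains a set of the form $\tau^{-1}(U)$, where $\tau\colon G\to K$ is a group homomorphism with dense image to a compact Hausdorff topological group $K$, and $U\subseteq K$ is an open set containing the identity of $K$. *)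

theory Defs
  imports "HOL-Analysis.Analysis" "HOL-Algebra.Coset"
begin

section \<open>Left-invariant means and upper Banach density\<close>

text \<open>
  The values of a measure outside \<open>Pow (carrier G)\<close> are unconstrained and never used.
\<close>

definition left_invariant_means :: "('g, 'm) monoid_scheme \<Rightarrow> ('g set \<Rightarrow> real) set" where
  "left_invariant_means G =
     {\<mu> \<in> Pow (carrier G) \<rightarrow> {0..1}.
        \<mu> (carrier G) = 1 \<and>
        additive (Pow (carrier G)) \<mu> \<and>
        (\<forall>g \<in> carrier G. \<forall>X \<subseteq> carrier G. \<mu> (g <#\<^bsub>G\<^esub> X) = \<mu> X)}"

definition amenable :: "('g, 'm) monoid_scheme \<Rightarrow> bool" where
  "amenable G \<longleftrightarrow> left_invariant_means G \<noteq> {}"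

text \<open>
  The supremum is taken in \<^typ>\<open>real\<close>, so this is meaningful only if \<open>G\<close> is amenable
  and \<open>X \<subseteq> carrier G\<close>.
\<close>

definition upper_banach_density :: "('g, 'm) monoid_scheme \<Rightarrow> 'g set \<Rightarrow> real" where
  "upper_banach_density G X = (SUP \<mu> \<in> left_invariant_means G. \<mu> X)"

section \<open>Bohr sets\<close>

locale topological_group = group K for K :: "('k, 'm) monoid_scheme" (structure) +
  fixes T :: "'k topology"
  assumes topspace_eq_carrier: "topspace T = carrier K"
    and continuous_mult: "continuous_map (prod_topology T T) T (\<lambda>(x, y). x \<otimes> y)"
    and continuous_inv: "continuous_map T T (\<lambda>x. inv x)"

definition dense_compact_hom ::
    "('g, 'm) monoid_scheme \<Rightarrow> ('k, 'n) monoid_scheme \<Rightarrow> 'k topology \<Rightarrow> ('g \<Rightarrow> 'k) \<Rightarrow> bool" where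
  "dense_compact_hom G K T \<tau> \<longleftrightarrow>
     topological_group K T \<and> compact_space T \<and> Hausdorff_space T \<and>
     \<tau> \<in> hom G K \<and> T closure_of (\<tau> ` carrier G) = topspace T"

text \<open>
  HOL cannot quantify over the type of \<open>K\<close> inside a formula.  A Hausdorff space with a dense
  image of \<open>G\<close> has at most as many points as there are sets of subsets of \<open>G\<close>, so it is enough
  to let \<open>K\<close> range over groups with elements in \<^typ>\<open>'g set set\<close>; lemma \<open>bohr0_setI\<close> below
  shows that groups over any other type give the same sets.
\<close>

definition bohr0_set :: "('g, 'm) monoid_scheme \<Rightarrow> 'g set \<Rightarrow> bool" where
  "bohr0_set G B \<longleftrightarrow> B \<subseteq> carrier G \<and>
     (\<exists>(K :: 'g set set monoid) T \<tau> U.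
        dense_compact_hom G K T \<tau> \<and> openin T U \<and> \<one>\<^bsub>K\<^esub> \<in> U \<and>
        \<tau> -` U \<inter> carrier G \<subseteq> B)"

lemma dense_compact_hom_transport:
  fixes G :: "('g, 'm) monoid_scheme" and K :: "('k, 'n) monoid_scheme" and f :: "'k \<Rightarrow> 'l"
  assumes bc: "dense_compact_hom G K T \<tau>" and inj: "inj_on f (carrier K)"
  obtains K' :: "'l monoid" and T' where
    "dense_compact_hom G K' T' (f \<circ> \<tau>)" "homeomorphic_map T T' f" "\<one>\<^bsub>K'\<^esub> = f \<one>\<^bsub>K\<^esub>"
proof -
  interpret topological_group K T
    using bc by (simp add: dense_compact_hom_def)
  define g where "g = inv_into (carrier K) f"
  define C where "C = f ` carrier K"
  define K' :: "'l monoid"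
    where "K' = \<lparr>carrier = C, monoid.mult = (\<lambda>x y. f (g x \<otimes>\<^bsub>K\<^esub> g y)), one = f \<one>\<^bsub>K\<^esub>\<rparr>"
  define T' where "T' = pullback_topology C g T"
  have gf [simp]: "g (f x) = x" if "x \<in> carrier K" for x
    using that inj by (simp add: g_def)
  have fg [simp]: "f (g x) = x" "g x \<in> carrier K" if "x \<in> C" for x
    using that by (auto simp: C_def)
  have fC [simp]: "f x \<in> C" if "x \<in> carrier K" for x
    using that by (simp add: C_def)
  have top': "topspace T' = C"
    by (auto simp: T'_def topspace_pullback_topology topspace_eq_carrier)
  have cg: "continuous_map T' T g"
    unfolding T'_def using continuous_map_pullback[of T T id C g] by (simp add: comp_def)
  have cf: "continuous_map T T' f"
    unfolding T'_def
  proof (rule continuous_map_pullback')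
    show "continuous_map T T (g \<circ> f)"
      by (rule continuous_map_eq[where f = id]) (auto simp: topspace_eq_carrier)
  qed (auto simp: topspace_eq_carrier)
  have hm: "homeomorphic_maps T T' f g"
    using cf cg by (auto simp: homeomorphic_maps_def top' topspace_eq_carrier)
  then have hf: "homeomorphic_map T T' f"
    by (auto simp: homeomorphic_map_maps)
  then have hs: "T homeomorphic_space T'"
    by (rule homeomorphic_map_imp_homeomorphic_space)
  have K'simps [simp]: "carrier K' = C" "x \<otimes>\<^bsub>K'\<^esub> y = f (g x \<otimes>\<^bsub>K\<^esub> g y)" "\<one>\<^bsub>K'\<^esub> = f \<one>\<^bsub>K\<^esub>" for x y
    by (simp_all add: K'_def)
  have grp: "group K'"
  proof (rule groupI)
    show "\<exists>y\<in>carrier K'. y \<otimes>\<^bsub>K'\<^esub> x = \<one>\<^bsub>K'\<^esub>" if "x \<in> carrier K'" for x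
      using that by (intro bexI[of _ "f (inv\<^bsub>K\<^esub> (g x))"]) auto
  qed (auto simp: m_assoc)
  interpret K': group K' by (rule grp)
  have inv': "inv\<^bsub>K'\<^esub> x = f (inv\<^bsub>K\<^esub> (g x))" if "x \<in> C" for x
    by (rule K'.inv_equality) (use that in auto)
  have "topological_group K' T'"
  proof
    show "topspace T' = carrier K'"
      by (simp add: top')
    have 1: "continuous_map (prod_topology T' T') (prod_topology T T) (\<lambda>p. (g (fst p), g (snd p)))"
      by (intro continuous_map_pairedI continuous_map_compose[OF continuous_map_fst cg, unfolded comp_def]
          continuous_map_compose[OF continuous_map_snd cg, unfolded comp_def])
    show "continuous_map (prod_topology T' T') T' (\<lambda>(x, y). x \<otimes>\<^bsub>K'\<^esub> y)"
      using continuous_map_compose[OF continuous_map_compose[OF 1 continuous_mult] cf]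
      by (simp add: comp_def case_prod_unfold)
    show "continuous_map T' T' (\<lambda>x. inv\<^bsub>K'\<^esub> x)"
      by (rule continuous_map_eq[OF continuous_map_compose[OF continuous_map_compose[OF cg continuous_inv] cf]])
        (simp add: top' inv')
  qed
  moreover have "compact_space T'" "Hausdorff_space T'"
    using bc hs homeomorphic_compact_space homeomorphic_Hausdorff_space
    by (auto simp: dense_compact_hom_def)
  moreover have hom: "\<tau> \<in> hom G K" and dense: "T closure_of (\<tau> ` carrier G) = topspace T"
    using bc by (auto simp: dense_compact_hom_def)
  have "f \<circ> \<tau> \<in> hom G K'"
    using hom by (auto simp: hom_def Pi_iff)
  moreover have "T' closure_of ((f \<circ> \<tau>) ` carrier G) = topspace T'"
  proof -
    have "\<tau> ` carrier G \<subseteq> topspace T"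
      using hom by (auto simp: topspace_eq_carrier hom_def)
    from homeomorphic_map_closure_of[OF hf this] show ?thesis
      by (simp add: image_comp dense homeomorphic_imp_surjective_map[OF hf])
  qed
  ultimately show thesis
    using that[of K' T'] hf by (simp add: dense_compact_hom_def)
qed

lemma bohr0_setI:
  fixes G :: "('g, 'm) monoid_scheme" and K :: "('k, 'n) monoid_scheme"
  assumes bc: "dense_compact_hom G K T \<tau>" and "openin T U" "\<one>\<^bsub>K\<^esub> \<in> U"
    and "\<tau> -` U \<inter> carrier G \<subseteq> B" and "B \<subseteq> carrier G"
  shows "bohr0_set G B"
proof -
  interpret topological_group K T
    using bc by (simp add: dense_compact_hom_def)
  have haus: "Hausdorff_space T" and hom: "\<tau> \<in> hom G K"
    and dense: "T closure_of (\<tau> ` carrier G) = topspace T"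
    using bc by (auto simp: dense_compact_hom_def)
  define f where "f k = {S. S \<subseteq> carrier G \<and> k \<in> T closure_of (\<tau> ` S)}" for k
  have inj: "inj_on f (carrier K)"
  proof (rule inj_onI, rule ccontr)
    fix k l assume kl: "k \<in> carrier K" "l \<in> carrier K" "f k = f l" "k \<noteq> l"
    then obtain V W where VW: "openin T V" "openin T W" "k \<in> V" "l \<in> W" "disjnt V W"
      using haus by (metis Hausdorff_space_def topspace_eq_carrier)
    define S where "S = \<tau> -` V \<inter> carrier G"
    have "k \<in> T closure_of (\<tau> ` S)"
      unfolding in_closure_of
    proof (intro conjI allI impI)
      show "k \<in> topspace T" using kl by (simp add: topspace_eq_carrier)
      fix N assume N: "k \<in> N \<and> openin T N"
      have "k \<in> T closure_of (\<tau> ` carrier G)"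
        using kl by (simp add: dense topspace_eq_carrier)
      moreover have "openin T (N \<inter> V)" "k \<in> N \<inter> V"
        using N VW by auto
      ultimately obtain y where "y \<in> \<tau> ` carrier G" "y \<in> N \<inter> V"
        unfolding in_closure_of by blast
      then show "\<exists>y. y \<in> \<tau> ` S \<and> y \<in> N"
        by (auto simp: S_def)
    qed
    then have "S \<in> f l"
      unfolding kl(3)[symmetric] by (auto simp: f_def S_def)
    then have "\<exists>y. y \<in> \<tau> ` S \<and> y \<in> W"
      using VW unfolding f_def in_closure_of by blast
    then show False
      using VW(5) by (auto simp: S_def disjnt_iff)
  qed
  obtain K' :: "'g set set monoid" and T' where
    K': "dense_compact_hom G K' T' (f \<circ> \<tau>)" "homeomorphic_map T T' f" "\<one>\<^bsub>K'\<^esub> = f \<one>\<^bsub>K\<^esub>"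
    by (rule dense_compact_hom_transport[OF bc inj])
  have sub: "U \<subseteq> carrier K"
    using openin_subset[OF \<open>openin T U\<close>] by (simp add: topspace_eq_carrier)
  have "openin T' (f ` U)"
    using homeomorphic_map_openness_eq[OF K'(2)] \<open>openin T U\<close> by blast
  moreover have "\<one>\<^bsub>K'\<^esub> \<in> f ` U"
    using K'(3) \<open>\<one>\<^bsub>K\<^esub> \<in> U\<close> by simp
  moreover have "(f \<circ> \<tau>) -` (f ` U) \<inter> carrier G \<subseteq> B"
  proof
    fix x assume x: "x \<in> (f \<circ> \<tau>) -` (f ` U) \<inter> carrier G"
    then have "\<tau> x \<in> carrier K"
      using hom by (auto simp: hom_def)
    with x sub inj have "\<tau> x \<in> U"
      by (auto dest: inj_onD)
    with x assms(4) show "x \<in> B" by auto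
  qed
  ultimately show ?thesis
    using K'(1) \<open>B \<subseteq> carrier G\<close> unfolding bohr0_set_def by blast
qed

end

theory Submission
  imports Defs "HOL-Probability.Discrete_Topology"
begin

text \<open>
  Fix an invariant mean \<open>\<mu>\<close> with \<open>\<mu> A > 0\<close> and let \<open>v\<close> be the indicator function of \<open>A\<close> in the
  semi-inner product space of bounded functions with \<open>\<langle>x, y\<rangle> = \<integral> x y d\<mu>\<close>.  If \<open>h\<close> is not in \<open>A A\<^sup>-\<^sup>1\<close>
  then \<open>\<langle>v, h v\<rangle> = \<mu> (A \<inter> h A) = 0\<close>.  Split \<open>v = x + w\<close> with \<open>x\<close> the projection of \<open>v\<close> onto the vectors
  whose orbit is totally bounded.  For every invariant mean \<open>I\<close> the operator
  \<open>T u = \<integral> \<langle>u, h v\<rangle> h v dI(h)\<close> is Hilbert--Schmidt, so \<open>T w\<close> has a totally bounded orbit, hence is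
  orthogonal to \<open>w\<close>, which says that \<open>\<integral> \<langle>w, h v\<rangle>\<^sup>2 dI(h) = 0\<close>.  On the other hand
  \<open>h \<mapsto> \<langle>x, h v\<rangle>\<close> is almost periodic, and \<open>\<langle>x, v\<rangle> > 0\<close> because constants are invariant; so
  \<open>{h. \<langle>x, h v\<rangle> > \<langle>x, v\<rangle> / 2}\<close> is a Bohr set, outside \<open>A A\<^sup>-\<^sup>1\<close> it is contained in
  \<open>{h. \<bar>\<langle>w, h v\<rangle>\<bar> > \<langle>x, v\<rangle> / 2}\<close>, and the latter set is null for every \<open>I\<close>.

  The space is not complete.  Vectors of its completion are therefore represented by bounded linear
  functionals on it, and vectors of the space itself only approximate them.
\<close>

section \<open>Integration against finitely additive measures\<close>

definition bounded_funs :: "'a set \<Rightarrow> ('a \<Rightarrow> real) set" where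
  "bounded_funs \<Omega> = {f. \<exists>C. \<forall>x\<in>\<Omega>. \<bar>f x\<bar> \<le> C}"

lemma bounded_funsI: "(\<And>x. x \<in> \<Omega> \<Longrightarrow> \<bar>f x\<bar> \<le> C) \<Longrightarrow> f \<in> bounded_funs \<Omega>"
  unfolding bounded_funs_def by blast

lemma bounded_funsE:
  assumes "f \<in> bounded_funs \<Omega>"
  obtains C where "C \<ge> 0" "\<And>x. x \<in> \<Omega> \<Longrightarrow> \<bar>f x\<bar> \<le> C"
proof -
  obtain C where "\<forall>x\<in>\<Omega>. \<bar>f x\<bar> \<le> C" using assms unfolding bounded_funs_def by blast
  then show thesis by (intro that[of "max C 0"]) force+
qed

lemma bounded_funs_const [simp, intro]: "(\<lambda>_. c) \<in> bounded_funs \<Omega>"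
  by (rule bounded_funsI[of _ _ "\<bar>c\<bar>"]) simp

lemma bounded_funs_add [intro]:
  assumes "f \<in> bounded_funs \<Omega>" "g \<in> bounded_funs \<Omega>"
  shows "(\<lambda>x. f x + g x) \<in> bounded_funs \<Omega>"
proof -
  obtain C D where "\<And>x. x \<in> \<Omega> \<Longrightarrow> \<bar>f x\<bar> \<le> C" "\<And>x. x \<in> \<Omega> \<Longrightarrow> \<bar>g x\<bar> \<le> D"
    using assms by (metis bounded_funsE)
  then show ?thesis by (intro bounded_funsI[of _ _ "C + D"]) (smt (verit))
qed

lemma bounded_funs_mult [intro]:
  assumes "f \<in> bounded_funs \<Omega>" "g \<in> bounded_funs \<Omega>"
  shows "(\<lambda>x. f x * g x) \<in> bounded_funs \<Omega>"
proof -
  obtain C D where "\<And>x. x \<in> \<Omega> \<Longrightarrow> \<bar>f x\<bar> \<le> C" "\<And>x. x \<in> \<Omega> \<Longrightarrow> \<bar>g x\<bar> \<le> D" "C \<ge> 0" "D \<ge> 0"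
    using assms by (metis bounded_funsE)
  then show ?thesis by (intro bounded_funsI[of _ _ "C * D"]) (simp add: abs_mult mult_mono)
qed

lemma bounded_funs_scale [intro]: "f \<in> bounded_funs \<Omega> \<Longrightarrow> (\<lambda>x. c * f x) \<in> bounded_funs \<Omega>"
  by (intro bounded_funs_mult) auto

lemma bounded_funs_uminus [intro]: "f \<in> bounded_funs \<Omega> \<Longrightarrow> (\<lambda>x. - f x) \<in> bounded_funs \<Omega>"
  using bounded_funs_scale[of f \<Omega> "-1"] by simp

lemma bounded_funs_diff [intro]:
  "f \<in> bounded_funs \<Omega> \<Longrightarrow> g \<in> bounded_funs \<Omega> \<Longrightarrow> (\<lambda>x. f x - g x) \<in> bounded_funs \<Omega>"
  using bounded_funs_add[of f \<Omega> "\<lambda>x. - g x"] by auto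

lemma bounded_funs_compose:
  "f \<in> bounded_funs \<Omega> \<Longrightarrow> (\<And>x. x \<in> \<Omega>' \<Longrightarrow> p x \<in> \<Omega>) \<Longrightarrow> (\<lambda>x. f (p x)) \<in> bounded_funs \<Omega>'"
  unfolding bounded_funs_def by blast

lemma abs_diff_le_all_imp_eq:
  fixes x y :: real
  assumes "\<And>e. e > 0 \<Longrightarrow> \<bar>x - y\<bar> \<le> e"
  shows "x = y"
  using field_le_epsilon[of "\<bar>x - y\<bar>" 0] assms by simp

text \<open>A positive normalised linear functional is axiomatised instead of a measure, so that the
  iterated mean \<open>J2\<close> on the square is again an instance.\<close>

locale mean =
  fixes \<Omega> :: "'a set" and J :: "('a \<Rightarrow> real) \<Rightarrow> real"
  assumes J_add: "\<lbrakk>f \<in> bounded_funs \<Omega>; g \<in> bounded_funs \<Omega>\<rbrakk> \<Longrightarrow> J (\<lambda>x. f x + g x) = J f + J g"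
    and J_scale: "f \<in> bounded_funs \<Omega> \<Longrightarrow> J (\<lambda>x. c * f x) = c * J f"
    and J_mono: "\<lbrakk>f \<in> bounded_funs \<Omega>; g \<in> bounded_funs \<Omega>; \<And>x. x \<in> \<Omega> \<Longrightarrow> f x \<le> g x\<rbrakk> \<Longrightarrow> J f \<le> J g"
    and J_one: "J (\<lambda>_. 1) = 1"

section \<open>The integral of a finitely additive probability measure\<close>

locale finitely_additive_prob =
  fixes \<Omega> :: "'a set" and m :: "'a set \<Rightarrow> real"
  assumes m_range: "m \<in> Pow \<Omega> \<rightarrow> {0..1}"
    and m_space: "m \<Omega> = 1"
    and m_additive: "additive (Pow \<Omega>) m"
begin

lemma m_empty: "m {} = 0"
  using m_additive unfolding additive_def by force

lemma m_Un: "\<lbrakk>X \<subseteq> \<Omega>; Y \<subseteq> \<Omega>; X \<inter> Y = {}\<rbrakk> \<Longrightarrow> m (X \<union> Y) = m X + m Y"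
  using m_additive unfolding additive_def by force

lemma m_UN:
  assumes "finite I" "\<And>i. i \<in> I \<Longrightarrow> X i \<subseteq> \<Omega>" "disjoint_family_on X I"
  shows "m (\<Union>i\<in>I. X i) = (\<Sum>i\<in>I. m (X i))"
  using assms
proof (induction I rule: finite_induct)
  case empty
  then show ?case by (simp add: m_empty)
next
  case (insert i I)
  have "X i \<inter> (\<Union>j\<in>I. X j) = {}"
    using insert.prems(2) insert.hyps unfolding disjoint_family_on_def by fastforce
  then have "m (\<Union>j\<in>insert i I. X j) = m (X i) + m (\<Union>j\<in>I. X j)"
    using insert.prems(1) by (simp add: UN_subset_iff m_Un)
  moreover have "disjoint_family_on X I"
    using insert.prems(2) by (rule disjoint_family_on_mono[rotated]) auto
  ultimately show ?case using insert by simp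
qed

definition simple_int :: "('a \<Rightarrow> real) \<Rightarrow> real" where
  "simple_int s = (\<Sum>a\<in>s ` \<Omega>. a * m {x\<in>\<Omega>. s x = a})"

text \<open>The level sets of \<open>p\<close> refine those of \<open>u\<close> composed with
  \<open>p\<close>. Taking for \<open>p\<close> the pair of two simple functions puts both on one
  common partition, which gives linearity and monotonicity.\<close>

lemma simple_int_comp:
  assumes "finite (p ` \<Omega>)"
  shows "simple_int (\<lambda>x. u (p x)) = (\<Sum>b\<in>p ` \<Omega>. u b * m {x\<in>\<Omega>. p x = b})"
proof -
  have *: "(\<Sum>b\<in>{b \<in> p ` \<Omega>. u b = a}. u b * m {x\<in>\<Omega>. p x = b}) = a * m {x\<in>\<Omega>. u (p x) = a}" for a
  proof -
    have "{x\<in>\<Omega>. u (p x) = a} = (\<Union>b\<in>{b \<in> p ` \<Omega>. u b = a}. {x\<in>\<Omega>. p x = b})"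
      by auto
    also have "m \<dots> = (\<Sum>b\<in>{b \<in> p ` \<Omega>. u b = a}. m {x\<in>\<Omega>. p x = b})"
      using assms by (intro m_UN) (auto simp: disjoint_family_on_def)
    finally show ?thesis by (simp add: sum_distrib_left)
  qed
  show ?thesis
    unfolding simple_int_def
    by (subst sum.image_gen[OF assms, where g = u and h = "\<lambda>b. u b * m {x\<in>\<Omega>. p x = b}"])
       (simp only: * image_image)
qed

lemma simple_int_linear:
  assumes "finite (s ` \<Omega>)" "finite (t ` \<Omega>)"
  shows "simple_int (\<lambda>x. a * s x + b * t x) = a * simple_int s + b * simple_int t"
proof -
  define p where "p x = (s x, t x)" for x
  have fin: "finite (p ` \<Omega>)"
    by (rule finite_subset[of _ "s ` \<Omega> \<times> t ` \<Omega>"]) (use assms in \<open>auto simp: p_def\<close>)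
  show ?thesis
    using simple_int_comp[OF fin, of "\<lambda>q. a * fst q + b * snd q"] simple_int_comp[OF fin, of fst]
      simple_int_comp[OF fin, of snd]
    by (simp add: p_def sum.distrib sum_distrib_left algebra_simps)
qed

lemma simple_int_mono:
  assumes "finite (s ` \<Omega>)" "finite (t ` \<Omega>)" "\<And>x. x \<in> \<Omega> \<Longrightarrow> s x \<le> t x"
  shows "simple_int s \<le> simple_int t"
proof -
  define p where "p x = (s x, t x)" for x
  have fin: "finite (p ` \<Omega>)"
    by (rule finite_subset[of _ "s ` \<Omega> \<times> t ` \<Omega>"]) (use assms in \<open>auto simp: p_def\<close>)
  have "(\<Sum>b\<in>p ` \<Omega>. fst b * m {x\<in>\<Omega>. p x = b}) \<le> (\<Sum>b\<in>p ` \<Omega>. snd b * m {x\<in>\<Omega>. p x = b})"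
    using m_range assms(3) by (intro sum_mono mult_right_mono) (auto simp: p_def Pi_iff)
  then show ?thesis
    using simple_int_comp[OF fin, of fst] simple_int_comp[OF fin, of snd] by (simp add: p_def)
qed

lemma simple_int_const: "simple_int (\<lambda>_. c) = c"
proof -
  have "\<Omega> \<noteq> {}" using m_space m_empty by auto
  then show ?thesis unfolding simple_int_def using m_space by (simp add: image_constant_conv)
qed

lemma simple_int_add_const:
  assumes "finite (s ` \<Omega>)"
  shows "simple_int (\<lambda>x. s x + c) = simple_int s + c"
  using simple_int_linear[OF assms, of "\<lambda>_. c" 1 1] by (simp add: simple_int_const image_constant_conv)

lemma simple_int_indicator:
  assumes "X \<subseteq> \<Omega>"
  shows "simple_int (indicator X) = m X"
proof -
  have fin: "finite ((\<lambda>x. x \<in> X) ` \<Omega>)" by (rule finite_subset[of _ UNIV]) auto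
  have "simple_int (indicator X) = (\<Sum>b\<in>(\<lambda>x. x \<in> X) ` \<Omega>. of_bool b * m {x\<in>\<Omega>. (x \<in> X) = b})"
    using simple_int_comp[OF fin, of of_bool] by (simp add: indicator_def[abs_def])
  \<comment> \<open>A truth value that is not attained has an empty level set, which has measure
    zero.\<close>
  also have "\<dots> = (\<Sum>b\<in>UNIV. of_bool b * m {x\<in>\<Omega>. (x \<in> X) = b})"
  proof (rule sum.mono_neutral_left, goal_cases)
    case 3
    have "b \<in> (\<lambda>x. x \<in> X) ` \<Omega>" if "{x\<in>\<Omega>. (x \<in> X) = b} \<noteq> {}" for b
      using that by blast
    then show ?case using m_empty by (metis DiffE mult_zero_right)
  qed auto
  also have "\<dots> = m X"
    using assms by (simp add: UNIV_bool Int_absorb1 Collect_conj_eq)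
  finally show ?thesis .
qed

text \<open>A lower integral. On bounded functions it behaves as an integral because these are
  uniform limits of functions with finite range.\<close>

definition integ :: "('a \<Rightarrow> real) \<Rightarrow> real" where
  "integ f = Sup {simple_int s | s. finite (s ` \<Omega>) \<and> (\<forall>x\<in>\<Omega>. s x \<le> f x)}"

text \<open>Lowering \<open>s\<close> by \<open>e\<close> gives a member of the set whose supremum
  is taken, and raising it by \<open>e\<close> bounds every member.\<close>

lemma integ_approx:
  assumes s: "finite (s ` \<Omega>)" and e: "\<And>x. x \<in> \<Omega> \<Longrightarrow> \<bar>f x - s x\<bar> \<le> e"
  shows "\<bar>integ f - simple_int s\<bar> \<le> e"
proof -
  let ?S = "{simple_int s | s. finite (s ` \<Omega>) \<and> (\<forall>x\<in>\<Omega>. s x \<le> f x)}"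
  have fin: "finite ((\<lambda>x. s x + c) ` \<Omega>)" for c
    using finite_imageI[OF s, of "\<lambda>y. y + c"] by (simp add: image_image)
  have lower: "simple_int s - e \<in> ?S"
    using fin[of "- e"] e simple_int_add_const[OF s, of "- e"]
    by (intro CollectI exI[of _ "\<lambda>x. s x + - e"]) (force simp: abs_le_iff)
  have upper: "y \<le> simple_int s + e" if "y \<in> ?S" for y
  proof -
    obtain t where t: "finite (t ` \<Omega>)" "\<forall>x\<in>\<Omega>. t x \<le> f x" "y = simple_int t"
      using \<open>y \<in> ?S\<close> by blast
    have "simple_int t \<le> simple_int (\<lambda>x. s x + e)"
      by (rule simple_int_mono) (use t fin e in \<open>force simp: abs_le_iff\<close>)+
    then show ?thesis using t simple_int_add_const[OF s] by simp
  qed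
  have "simple_int s - e \<le> integ f"
    unfolding integ_def by (rule cSup_upper[OF lower]) (use upper in \<open>auto intro!: bdd_aboveI\<close>)
  moreover have "integ f \<le> simple_int s + e"
    unfolding integ_def by (rule cSup_least) (use lower upper in auto)
  ultimately show ?thesis by linarith
qed

text \<open>The values are rounded down to multiples of \<open>e\<close>; boundedness leaves
  finitely many of them.\<close>

lemma simple_approx:
  assumes "f \<in> bounded_funs \<Omega>" "e > 0"
  obtains s where "finite (s ` \<Omega>)" "\<And>x. x \<in> \<Omega> \<Longrightarrow> \<bar>f x - s x\<bar> \<le> e"
proof -
  obtain C where C: "\<And>x. x \<in> \<Omega> \<Longrightarrow> \<bar>f x\<bar> \<le> C" using assms by (metis bounded_funsE)
  define s where "s x = e * of_int \<lfloor>f x / e\<rfloor>" for x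
  have "(\<lambda>x. \<lfloor>f x / e\<rfloor>) ` \<Omega> \<subseteq> {\<lfloor>- C / e\<rfloor>..\<lfloor>C / e\<rfloor>}"
    using C \<open>e > 0\<close> by (auto intro!: floor_mono divide_right_mono simp: abs_le_iff)
      (smt (verit) C divide_right_mono floor_mono minus_divide_left)
  then have "finite ((\<lambda>x. \<lfloor>f x / e\<rfloor>) ` \<Omega>)" by (rule finite_subset) auto
  then have "finite ((\<lambda>z. e * of_int z) ` (\<lambda>x. \<lfloor>f x / e\<rfloor>) ` \<Omega>)" by (rule finite_imageI)
  then have 1: "finite (s ` \<Omega>)" by (simp add: image_image s_def)
  have 2: "\<bar>f x - s x\<bar> \<le> e" for x
  proof -
    have "0 \<le> f x / e - of_int \<lfloor>f x / e\<rfloor>" "f x / e - of_int \<lfloor>f x / e\<rfloor> \<le> 1"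
      by linarith+
    then have "0 \<le> e * (f x / e - of_int \<lfloor>f x / e\<rfloor>)" "e * (f x / e - of_int \<lfloor>f x / e\<rfloor>) \<le> e * 1"
      using \<open>e > 0\<close> by (auto intro!: mult_left_mono mult_nonneg_nonneg simp del: mult_1_right)
    then show ?thesis using \<open>e > 0\<close> by (simp add: s_def right_diff_distrib)
  qed
  show thesis using that 1 2 by blast
qed

lemma integ_simple: "finite (s ` \<Omega>) \<Longrightarrow> integ s = simple_int s"
  using integ_approx[of s s 0] by simp

lemma integ_indicator: "X \<subseteq> \<Omega> \<Longrightarrow> integ (indicator X) = m X"
  by (subst integ_simple)
     (auto simp: simple_int_indicator indicator_def intro: finite_subset[of _ "{0, 1}"])

lemma integ_linear:
  assumes "f \<in> bounded_funs \<Omega>" "g \<in> bounded_funs \<Omega>"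
  shows "integ (\<lambda>x. a * f x + b * g x) = a * integ f + b * integ g"
proof -
  have tri: "\<lbrakk>\<bar>y - s\<bar> \<le> r; \<bar>z - s\<bar> \<le> r; 2 * r \<le> e\<rbrakk> \<Longrightarrow> \<bar>y - z\<bar> \<le> e" for y z s r e :: real
    by linarith
  have "\<bar>integ (\<lambda>x. a * f x + b * g x) - (a * integ f + b * integ g)\<bar> \<le> e" if "e > 0" for e
  proof -
    \<comment> \<open>Two errors of size \<open>\<bar>a\<bar> * d + \<bar>b\<bar> * d\<close> have
      to fit into \<open>e\<close>; the summand 1 keeps the denominator positive.\<close>
    define d where "d = e / (2 * (\<bar>a\<bar> + \<bar>b\<bar> + 1))"
    have d: "d > 0" using that by (simp add: d_def add_nonneg_pos)
    have de: "2 * (\<bar>a\<bar> * d + \<bar>b\<bar> * d) \<le> e"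
    proof -
      have "2 * (\<bar>a\<bar> + \<bar>b\<bar> + 1) * d = e" by (simp add: d_def add_nonneg_pos)
      then show ?thesis using d by (simp add: algebra_simps)
    qed
    obtain s where s: "finite (s ` \<Omega>)" "\<And>x. x \<in> \<Omega> \<Longrightarrow> \<bar>f x - s x\<bar> \<le> d"
      using simple_approx[OF assms(1) d] by blast
    obtain t where t: "finite (t ` \<Omega>)" "\<And>x. x \<in> \<Omega> \<Longrightarrow> \<bar>g x - t x\<bar> \<le> d"
      using simple_approx[OF assms(2) d] by blast
    have comb: "\<bar>a * y + b * z\<bar> \<le> \<bar>a\<bar> * d + \<bar>b\<bar> * d" if "\<bar>y\<bar> \<le> d" "\<bar>z\<bar> \<le> d" for y z
    proof -
      have "\<bar>a * y\<bar> \<le> \<bar>a\<bar> * d" "\<bar>b * z\<bar> \<le> \<bar>b\<bar> * d"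
        using that by (auto simp: abs_mult intro: mult_left_mono)
      then show ?thesis by linarith
    qed
    have fin: "finite ((\<lambda>x. a * s x + b * t x) ` \<Omega>)"
      by (rule finite_subset[of _ "(\<lambda>(p, q). a * p + b * q) ` (s ` \<Omega> \<times> t ` \<Omega>)"]) (use s t in auto)
    have "\<bar>integ (\<lambda>x. a * f x + b * g x) - simple_int (\<lambda>x. a * s x + b * t x)\<bar> \<le> \<bar>a\<bar> * d + \<bar>b\<bar> * d"
    proof (rule integ_approx[OF fin])
      fix x assume "x \<in> \<Omega>"
      then show "\<bar>a * f x + b * g x - (a * s x + b * t x)\<bar> \<le> \<bar>a\<bar> * d + \<bar>b\<bar> * d"
        using comb[OF s(2) t(2)] by (simp add: algebra_simps)
    qed
    moreover have "\<bar>(a * integ f + b * integ g) - simple_int (\<lambda>x. a * s x + b * t x)\<bar> \<le> \<bar>a\<bar> * d + \<bar>b\<bar> * d"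
    proof -
      have "a * integ f + b * integ g - simple_int (\<lambda>x. a * s x + b * t x)
          = a * (integ f - simple_int s) + b * (integ g - simple_int t)"
        by (simp add: simple_int_linear s t algebra_simps)
      also have "\<bar>\<dots>\<bar> \<le> \<bar>a\<bar> * d + \<bar>b\<bar> * d"
        by (intro comb integ_approx s t)
      finally show ?thesis .
    qed
    ultimately show ?thesis using de by (rule tri)
  qed
  then show ?thesis by (rule abs_diff_le_all_imp_eq)
qed

sublocale mean \<Omega> integ
proof
  fix f g :: "'a \<Rightarrow> real" and c
  assume f: "f \<in> bounded_funs \<Omega>"
  show "integ (\<lambda>x. c * f x) = c * integ f"
    using integ_linear[OF f f, of c 0] by simp
  assume g: "g \<in> bounded_funs \<Omega>"
  show "integ (\<lambda>x. f x + g x) = integ f + integ g"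
    using integ_linear[OF f g, of 1 1] by simp
  assume le: "\<And>x. x \<in> \<Omega> \<Longrightarrow> f x \<le> g x"
  show "integ f \<le> integ g"
  proof (rule field_le_epsilon)
    fix e :: real assume "e > 0"
    then have e: "e / 4 > 0" by simp
    obtain s where s: "finite (s ` \<Omega>)" "\<And>x. x \<in> \<Omega> \<Longrightarrow> \<bar>f x - s x\<bar> \<le> e / 4"
      using simple_approx[OF f e] by blast
    obtain t where t: "finite (t ` \<Omega>)" "\<And>x. x \<in> \<Omega> \<Longrightarrow> \<bar>g x - t x\<bar> \<le> e / 4"
      using simple_approx[OF g e] by blast
    have fin: "finite ((\<lambda>x. t x + e / 2) ` \<Omega>)"
      using finite_imageI[OF t(1), of "\<lambda>y. y + e / 2"] by (simp add: image_image)
    have "simple_int s \<le> simple_int (\<lambda>x. t x + e / 2)"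
    proof (rule simple_int_mono[OF s(1) fin])
      fix x assume x: "x \<in> \<Omega>"
      show "s x \<le> t x + e / 2" using s(2)[OF x] t(2)[OF x] le[OF x] by linarith
    qed
    then show "integ f \<le> integ g + e"
      using integ_approx[OF s] integ_approx[OF t] simple_int_add_const[OF t(1), of "e / 2"] by linarith
  qed
next
  show "integ (\<lambda>_. 1) = 1"
    by (subst integ_simple) (auto simp: simple_int_const image_constant_conv)
qed

text \<open>For a simple function the substitution changes neither the range, as \<open>p\<close> is
  onto, nor the measures of the level sets. It is applied to left translations.\<close>

lemma integ_measure_preserving:
  assumes f: "f \<in> bounded_funs \<Omega>" and p: "p ` \<Omega> = \<Omega>"
    and mp: "\<And>X. X \<subseteq> \<Omega> \<Longrightarrow> m {x\<in>\<Omega>. p x \<in> X} = m X"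
  shows "integ (\<lambda>x. f (p x)) = integ f"
proof -
  have "\<bar>integ (\<lambda>x. f (p x)) - integ f\<bar> \<le> e" if "e > 0" for e
  proof -
    have e: "e / 2 > 0" using that by simp
    obtain s where s: "finite (s ` \<Omega>)" "\<And>x. x \<in> \<Omega> \<Longrightarrow> \<bar>f x - s x\<bar> \<le> e / 2"
      using simple_approx[OF f e] by blast
    have im: "(\<lambda>x. s (p x)) ` \<Omega> = s ` \<Omega>" using p by (metis image_image)
    have "m {x\<in>\<Omega>. s (p x) = a} = m {x\<in>\<Omega>. s x = a}" for a
    proof -
      have "{x\<in>\<Omega>. s (p x) = a} = {x\<in>\<Omega>. p x \<in> {x\<in>\<Omega>. s x = a}}" using p by auto
      then show ?thesis using mp[of "{x\<in>\<Omega>. s x = a}"] by auto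
    qed
    then have "simple_int (\<lambda>x. s (p x)) = simple_int s" by (simp add: simple_int_def im)
    moreover have "\<bar>integ (\<lambda>x. f (p x)) - simple_int (\<lambda>x. s (p x))\<bar> \<le> e / 2"
      by (rule integ_approx) (use im s p in auto)
    ultimately show ?thesis using integ_approx[OF s] by linarith
  qed
  then show ?thesis by (rule abs_diff_le_all_imp_eq)
qed

end

section \<open>The semi-inner product of a mean\<close>

text \<open>Many estimates below are proved with a positive slack, such as the error of representing
  a functional by a vector; continuity at 0 then removes the slack.\<close>

lemma le_at_zero_of_isCont:
  fixes F :: "real \<Rightarrow> real"
  assumes "\<And>\<epsilon>. 0 < \<epsilon> \<Longrightarrow> \<delta> \<le> F \<epsilon>" "isCont F 0"
  shows "\<delta> \<le> F 0"
proof (rule tendsto_lowerbound)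
  show "(F \<longlongrightarrow> F 0) (at_right 0)"
    using assms(2) unfolding isCont_def by (rule filterlim_mono) (auto simp: at_le)
  show "\<forall>\<^sub>F \<epsilon> in at_right 0. \<delta> \<le> F \<epsilon>"
    by (rule eventually_at_right_less[THEN eventually_mono]) (rule assms(1))
qed simp

lemma quadratic_nonneg_imp_discriminant:
  fixes a b c :: real
  assumes "\<And>t. 0 \<le> a + 2 * t * b + t\<^sup>2 * c" and "c \<ge> 0"
  shows "b\<^sup>2 \<le> a * c"
proof (cases "c = 0")
  case True
  have "b = 0"
  proof (rule ccontr)
    assume "b \<noteq> 0"
    \<comment> \<open>With this \<open>t\<close> the expression \<open>a + 2 * t * b\<close> would
      be -1.\<close>
    define t where "t = - (a + 1) / (2 * b)"
    have "2 * t * b = - (a + 1)" using \<open>b \<noteq> 0\<close> by (simp add: t_def)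
    moreover have "0 \<le> a + 2 * t * b" using assms(1)[of t] True by simp
    ultimately show False by linarith
  qed
  then show ?thesis using True by simp
next
  case False
  \<comment> \<open>The quadratic is evaluated at its minimiser.\<close>
  have "0 \<le> (a + 2 * (- b / c) * b + (- b / c)\<^sup>2 * c) * c"
    using assms(1)[of "- b / c"] assms(2) by (rule mult_nonneg_nonneg)
  also have "\<dots> = a * c - b\<^sup>2"
    using False by (simp add: power2_eq_square algebra_simps)
  finally show ?thesis by simp
qed

context mean
begin

lemma J_cong: "\<lbrakk>f \<in> bounded_funs \<Omega>; \<And>x. x \<in> \<Omega> \<Longrightarrow> f x = g x\<rbrakk> \<Longrightarrow> J f = J g"
  by (intro antisym J_mono) (auto simp: bounded_funs_def)

lemma J_const: "J (\<lambda>_. c) = c"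
  using J_scale[of "\<lambda>_. 1" c] by (simp add: J_one)

lemma J_diff:
  "\<lbrakk>f \<in> bounded_funs \<Omega>; g \<in> bounded_funs \<Omega>\<rbrakk> \<Longrightarrow> J (\<lambda>x. f x - g x) = J f - J g"
  using J_add[of f "\<lambda>x. -1 * g x"] J_scale[of g "-1"] by (auto simp: bounded_funs_uminus)

lemma J_abs_le:
  assumes "\<And>x. x \<in> \<Omega> \<Longrightarrow> \<bar>f x\<bar> \<le> C"
  shows "\<bar>J f\<bar> \<le> C"
proof -
  have "f \<in> bounded_funs \<Omega>" using assms by (rule bounded_funsI)
  then have "J f \<le> J (\<lambda>_. C)" "J (\<lambda>_. - C) \<le> J f"
    by (intro J_mono; use assms in \<open>force simp: abs_le_iff\<close>)+
  then show ?thesis by (simp add: J_const abs_le_iff)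
qed

lemma J_diff_abs_le:
  assumes "f \<in> bounded_funs \<Omega>" "g \<in> bounded_funs \<Omega>" "\<And>x. x \<in> \<Omega> \<Longrightarrow> \<bar>f x - g x\<bar> \<le> C"
  shows "\<bar>J f - J g\<bar> \<le> C"
  using J_abs_le[of "\<lambda>x. f x - g x"] assms by (simp add: J_diff)

section \<open>The semi-inner product and its seminorm\<close>

definition ip :: "('a \<Rightarrow> real) \<Rightarrow> ('a \<Rightarrow> real) \<Rightarrow> real" where
  "ip f g = J (\<lambda>x. f x * g x)"

definition nrm :: "('a \<Rightarrow> real) \<Rightarrow> real" where
  "nrm f = sqrt (ip f f)"

lemma ip_commute: "ip f g = ip g f"
  by (simp add: ip_def mult.commute)

lemma ip_lin:
  assumes "f \<in> bounded_funs \<Omega>" "g \<in> bounded_funs \<Omega>" "h \<in> bounded_funs \<Omega>"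
  shows "ip f (\<lambda>x. g x + t * h x) = ip f g + t * ip f h"
proof -
  have "ip f (\<lambda>x. g x + t * h x) = J (\<lambda>x. f x * g x + t * (f x * h x))"
    by (simp add: ip_def algebra_simps)
  then show ?thesis
    unfolding ip_def using assms by (simp add: J_add J_scale bounded_funs_mult bounded_funs_scale)
qed

lemma ip_ge_0: "f \<in> bounded_funs \<Omega> \<Longrightarrow> 0 \<le> ip f f"
  unfolding ip_def using J_mono[of "\<lambda>_. 0" "\<lambda>x. f x * f x"] by (auto simp: J_const)

lemma nrm_ge_0 [simp]: "f \<in> bounded_funs \<Omega> \<Longrightarrow> 0 \<le> nrm f"
  by (simp add: nrm_def ip_ge_0)

lemma nrm_sq: "f \<in> bounded_funs \<Omega> \<Longrightarrow> (nrm f)\<^sup>2 = ip f f"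
  by (simp add: nrm_def ip_ge_0)

lemma nrm_le_1:
  assumes "\<And>x. x \<in> \<Omega> \<Longrightarrow> \<bar>f x\<bar> \<le> 1"
  shows "nrm f \<le> 1"
proof -
  have "\<bar>ip f f\<bar> \<le> 1"
    unfolding ip_def by (rule J_abs_le) (use assms abs_square_le_1 in \<open>auto simp: abs_mult power2_eq_square\<close>)
  then show ?thesis by (simp add: nrm_def)
qed

lemma ip_lin_lin:
  assumes "f \<in> bounded_funs \<Omega>" "g \<in> bounded_funs \<Omega>"
  shows "ip (\<lambda>x. f x + t * g x) (\<lambda>x. f x + t * g x) = ip f f + 2 * t * ip f g + t\<^sup>2 * ip g g"
proof -
  define c where "c = (\<lambda>x. f x + t * g x)"
  have c: "c \<in> bounded_funs \<Omega>" using assms by (auto simp: c_def)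
  have "ip c c = ip c f + t * ip c g"
    using ip_lin[OF c assms] by (simp add: c_def)
  moreover have "ip c f = ip f f + t * ip f g"
    using ip_lin[OF assms(1) assms] ip_commute[of c f] by (simp add: c_def)
  moreover have "ip c g = ip f g + t * ip g g"
    using ip_lin[OF assms(2) assms] ip_commute[of c g] ip_commute[of g f] by (simp add: c_def)
  ultimately show ?thesis
    by (simp add: c_def power2_eq_square algebra_simps)
qed

lemma Cauchy_Schwarz:
  assumes "f \<in> bounded_funs \<Omega>" "g \<in> bounded_funs \<Omega>"
  shows "\<bar>ip f g\<bar> \<le> nrm f * nrm g"
proof -
  have "(ip f g)\<^sup>2 \<le> ip f f * ip g g"
  proof (rule quadratic_nonneg_imp_discriminant)
    show "0 \<le> ip f f + 2 * t * ip f g + t\<^sup>2 * ip g g" for t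
      using ip_ge_0[OF bounded_funs_add[OF assms(1) bounded_funs_scale[OF assms(2)]]] ip_lin_lin[OF assms]
      by simp
  qed (use assms ip_ge_0 in auto)
  then have "sqrt ((ip f g)\<^sup>2) \<le> sqrt (ip f f * ip g g)" by (rule real_sqrt_le_mono)
  then show ?thesis by (simp add: nrm_def real_sqrt_mult)
qed

text \<open>\<open>X\<close> is a near minimiser of the quadratic functional \<open>Q\<close> on the
  subspace \<open>S\<close>. Moving from \<open>X\<close> along \<open>y\<close> lowers
  \<open>Q\<close> by at most the square of \<open>\<epsilon>\<close>, and the discriminant of the
  resulting quadratic in \<open>t\<close> is the claim. An exact minimiser may fail to exist because
  \<open>S\<close> need not be complete.\<close>

lemma approx_Riesz:
  assumes S: "S \<subseteq> bounded_funs \<Omega>" "S \<noteq> {}"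
    and lin: "\<And>x y t. \<lbrakk>x \<in> S; y \<in> S\<rbrakk> \<Longrightarrow> (\<lambda>a. x a + t * y a) \<in> S"
    and L: "\<And>x y t. \<lbrakk>x \<in> S; y \<in> S\<rbrakk> \<Longrightarrow> L (\<lambda>a. x a + t * y a) = L x + t * L y"
    and bd: "\<And>y. y \<in> S \<Longrightarrow> \<bar>L y\<bar> \<le> C * nrm y"
    and "\<epsilon> > 0"
  obtains X where "X \<in> S" "\<And>y. y \<in> S \<Longrightarrow> \<bar>ip X y - L y\<bar> \<le> \<epsilon> * nrm y"
proof -
  define Q where "Q y = ip y y - 2 * L y" for y
  \<comment> \<open>Completing the square shows that \<open>Q\<close> is bounded below, so that its
    infimum makes sense.\<close>
  have Q_ge: "Q y \<ge> - C\<^sup>2" if "y \<in> S" for y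
  proof -
    have "0 \<le> (nrm y - C)\<^sup>2" by simp
    then have "2 * (C * nrm y) \<le> ip y y + C\<^sup>2"
      using that S by (simp add: nrm_sq subset_iff power2_diff mult_ac)
    then show ?thesis using bd[OF that] unfolding Q_def by linarith
  qed
  then have bdd: "bdd_below (Q ` S)" by (intro bdd_belowI[of _ "- C\<^sup>2"]) auto
  have "\<exists>q\<in>Q ` S. q < Inf (Q ` S) + \<epsilon>\<^sup>2"
    using S \<open>\<epsilon> > 0\<close> by (intro cInf_lessD) auto
  then obtain X where X: "X \<in> S" "Q X < Inf (Q ` S) + \<epsilon>\<^sup>2" by blast
  have "\<bar>ip X y - L y\<bar> \<le> \<epsilon> * nrm y" if y: "y \<in> S" for y
  proof -
    have XB: "X \<in> bounded_funs \<Omega>" "y \<in> bounded_funs \<Omega>" using X y S by auto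
    have "(ip X y - L y)\<^sup>2 \<le> \<epsilon>\<^sup>2 * ip y y"
    proof (rule quadratic_nonneg_imp_discriminant)
      fix t
      have "Inf (Q ` S) \<le> Q (\<lambda>a. X a + t * y a)"
        by (rule cInf_lower) (use bdd lin X y in auto)
      also have "\<dots> = Q X + 2 * t * (ip X y - L y) + t\<^sup>2 * ip y y"
        unfolding Q_def using XB X y by (simp add: ip_lin_lin L algebra_simps)
      finally show "0 \<le> \<epsilon>\<^sup>2 + 2 * t * (ip X y - L y) + t\<^sup>2 * ip y y"
        using X by linarith
    qed (use XB ip_ge_0 in auto)
    then have "sqrt ((ip X y - L y)\<^sup>2) \<le> sqrt (\<epsilon>\<^sup>2 * ip y y)" by (rule real_sqrt_le_mono)
    then show ?thesis using \<open>\<epsilon> > 0\<close> by (simp add: nrm_def real_sqrt_mult)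
  qed
  then show thesis using that X by blast
qed

text \<open>\<open>C\<close> bounds the dual norm of \<open>w\<close>. Hence
  \<open>functional \<epsilon> (\<lambda>y. u y - w y)\<close>, for linear \<open>u\<close> and
  \<open>w\<close>, says that they are within \<open>\<epsilon>\<close> of each other as vectors of
  the completion.\<close>

definition functional :: "real \<Rightarrow> (('a \<Rightarrow> real) \<Rightarrow> real) \<Rightarrow> bool" where
  "functional C w \<longleftrightarrow>
     (\<forall>x\<in>bounded_funs \<Omega>. \<forall>y\<in>bounded_funs \<Omega>. \<forall>t. w (\<lambda>a. x a + t * y a) = w x + t * w y) \<and>
     (\<forall>y\<in>bounded_funs \<Omega>. \<bar>w y\<bar> \<le> C * nrm y)"

lemma functional_lin:
  "\<lbrakk>functional C w; x \<in> bounded_funs \<Omega>; y \<in> bounded_funs \<Omega>\<rbrakk>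
    \<Longrightarrow> w (\<lambda>a. x a + t * y a) = w x + t * w y"
  by (simp add: functional_def)

lemma functional_bound: "\<lbrakk>functional C w; y \<in> bounded_funs \<Omega>\<rbrakk> \<Longrightarrow> \<bar>w y\<bar> \<le> C * nrm y"
  by (simp add: functional_def)

lemma functional_nonneg:
  assumes "functional C w" shows "C \<ge> 0"
proof -
  have "nrm (\<lambda>_. 1) = 1" by (simp add: nrm_def ip_def J_one)
  then show ?thesis using functional_bound[OF assms, of "\<lambda>_. 1"] by auto
qed

lemma functional_diff:
  "\<lbrakk>functional C w; x \<in> bounded_funs \<Omega>; y \<in> bounded_funs \<Omega>\<rbrakk> \<Longrightarrow> w (\<lambda>a. x a - y a) = w x - w y"
  using functional_lin[of C w x y "-1"] by simp

text \<open>The difference of the two functions has seminorm zero. This matters because identities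
  between shifts hold only at points of the group.\<close>

lemma functional_cong:
  assumes "functional C w" "x \<in> bounded_funs \<Omega>" "\<And>a. a \<in> \<Omega> \<Longrightarrow> x a = y a"
  shows "w x = w y"
proof -
  have y: "y \<in> bounded_funs \<Omega>" using assms(2,3) by (auto simp: bounded_funs_def)
  have "ip (\<lambda>a. x a - y a) (\<lambda>a. x a - y a) = J (\<lambda>_. 0)"
    unfolding ip_def by (rule J_cong) (use assms(2,3) y in auto)
  then have "nrm (\<lambda>a. x a - y a) = 0" by (simp add: nrm_def J_const)
  then have "w (\<lambda>a. x a - y a) = 0"
    using functional_bound[OF assms(1), of "\<lambda>a. x a - y a"] assms(2) y by auto
  then show ?thesis using functional_diff[OF assms(1,2) y] by simp
qed

lemma functional_ip:
  assumes "x \<in> bounded_funs \<Omega>" shows "functional (nrm x) (ip x)"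
  using assms by (auto simp: functional_def ip_lin Cauchy_Schwarz)

lemma functional_mono:
  "functional C w \<Longrightarrow> C \<le> D \<Longrightarrow> functional D w"
  unfolding functional_def by (meson mult_right_mono nrm_ge_0 order_trans)

lemma functional_comb:
  assumes "functional C x" "functional D y"
  shows "functional (C + \<bar>t\<bar> * D) (\<lambda>z. x z + t * y z)"
  unfolding functional_def
proof (intro conjI ballI allI)
  fix f assume f: "f \<in> bounded_funs \<Omega>"
  have "\<bar>t * y f\<bar> \<le> \<bar>t\<bar> * (D * nrm f)"
    using functional_bound[OF assms(2) f] by (auto simp: abs_mult intro: mult_left_mono)
  then show "\<bar>x f + t * y f\<bar> \<le> (C + \<bar>t\<bar> * D) * nrm f"
    using functional_bound[OF assms(1) f] abs_triangle_ineq[of "x f" "t * y f"]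
    by (simp add: algebra_simps)
qed (simp add: functional_lin[OF assms(1)] functional_lin[OF assms(2)] algebra_simps)

lemma functional_approx:
  assumes w: "functional C w" and "\<epsilon> > 0"
  obtains W where "W \<in> bounded_funs \<Omega>" "functional \<epsilon> (\<lambda>y. ip W y - w y)" "nrm W \<le> C + \<epsilon>"
proof -
  have ne: "bounded_funs \<Omega> \<noteq> {}" using bounded_funs_const by blast
  have lin: "(\<lambda>a. x a + t * y a) \<in> bounded_funs \<Omega>"
    if "x \<in> bounded_funs \<Omega>" "y \<in> bounded_funs \<Omega>" for x y :: "'a \<Rightarrow> real" and t
    using that by (intro bounded_funs_add bounded_funs_scale)
  obtain W where W: "W \<in> bounded_funs \<Omega>"
    "\<And>y. y \<in> bounded_funs \<Omega> \<Longrightarrow> \<bar>ip W y - w y\<bar> \<le> \<epsilon> * nrm y"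
    using approx_Riesz[OF subset_refl ne lin functional_lin[OF w] functional_bound[OF w] \<open>\<epsilon> > 0\<close>]
    by metis
  \<comment> \<open>Testing the approximation on \<open>W\<close> itself bounds its norm.\<close>
  have "ip W W \<le> C * nrm W + \<epsilon> * nrm W"
    using W(2)[OF W(1)] functional_bound[OF w W(1)] by linarith
  then have "nrm W * nrm W \<le> (C + \<epsilon>) * nrm W"
    using nrm_sq[OF W(1)] by (simp add: power2_eq_square distrib_right)
  then have n: "nrm W \<le> C + \<epsilon>" if "nrm W > 0"
    using that by simp
  have "nrm W \<le> C + \<epsilon>" using n \<open>\<epsilon> > 0\<close> functional_nonneg[OF w] by (cases "nrm W > 0") auto
  moreover have "functional \<epsilon> (\<lambda>y. ip W y - w y)"
    unfolding functional_def
    using W functional_lin[OF w] by (auto simp: ip_lin algebra_simps)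
  ultimately show thesis using that W by blast
qed

section \<open>Approximation by operators of finite rank\<close>

text \<open>The inner product of this iterated mean factorises on product functions, so it models
  the Hilbert space tensor square.\<close>

definition J2 :: "('a \<times> 'a \<Rightarrow> real) \<Rightarrow> real" where
  "J2 F = J (\<lambda>a. J (\<lambda>b. F (a, b)))"

lemma J2_section:
  assumes "F \<in> bounded_funs (\<Omega> \<times> \<Omega>)"
  shows "a \<in> \<Omega> \<Longrightarrow> (\<lambda>b. F (a, b)) \<in> bounded_funs \<Omega>" "(\<lambda>a. J (\<lambda>b. F (a, b))) \<in> bounded_funs \<Omega>"
proof -
  obtain C where C: "\<And>p. p \<in> \<Omega> \<times> \<Omega> \<Longrightarrow> \<bar>F p\<bar> \<le> C" using assms by (metis bounded_funsE)
  show "a \<in> \<Omega> \<Longrightarrow> (\<lambda>b. F (a, b)) \<in> bounded_funs \<Omega>"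
    by (rule bounded_funsI[of _ _ C]) (use C in auto)
  show "(\<lambda>a. J (\<lambda>b. F (a, b))) \<in> bounded_funs \<Omega>"
    by (rule bounded_funsI[of _ _ C], rule J_abs_le) (use C in auto)
qed

lemma mean_J2: "mean (\<Omega> \<times> \<Omega>) J2"
proof
  fix f g :: "'a \<times> 'a \<Rightarrow> real" and c
  assume f: "f \<in> bounded_funs (\<Omega> \<times> \<Omega>)"
  have "J2 (\<lambda>x. c * f x) = J (\<lambda>a. c * J (\<lambda>b. f (a, b)))"
    unfolding J2_def
    by (rule J_cong[OF J2_section(2)]) (use f in \<open>auto intro!: J_scale J2_section bounded_funs_scale\<close>)
  then show "J2 (\<lambda>x. c * f x) = c * J2 f"
    unfolding J2_def using f by (simp add: J_scale J2_section)
  assume g: "g \<in> bounded_funs (\<Omega> \<times> \<Omega>)"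
  have "J2 (\<lambda>x. f x + g x) = J (\<lambda>a. J (\<lambda>b. f (a, b)) + J (\<lambda>b. g (a, b)))"
    unfolding J2_def
    by (rule J_cong[OF J2_section(2)]) (use f g in \<open>auto intro!: J_add J2_section bounded_funs_add\<close>)
  then show "J2 (\<lambda>x. f x + g x) = J2 f + J2 g"
    unfolding J2_def using f g by (simp add: J_add J2_section)
  assume "\<And>x. x \<in> \<Omega> \<times> \<Omega> \<Longrightarrow> f x \<le> g x"
  then show "J2 f \<le> J2 g"
    unfolding J2_def using f g by (intro J_mono J2_section) auto
next
  show "J2 (\<lambda>_. 1) = 1" by (simp add: J2_def J_one)
qed

interpretation J2: mean "\<Omega> \<times> \<Omega>" J2
  by (rule mean_J2)

definition tensor :: "('a \<Rightarrow> real) \<Rightarrow> ('a \<Rightarrow> real) \<Rightarrow> 'a \<times> 'a \<Rightarrow> real" where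
  "tensor x y = (\<lambda>p. x (fst p) * y (snd p))"

lemma tensor_bounded:
  "\<lbrakk>x \<in> bounded_funs \<Omega>; y \<in> bounded_funs \<Omega>\<rbrakk> \<Longrightarrow> tensor x y \<in> bounded_funs (\<Omega> \<times> \<Omega>)"
  unfolding tensor_def
  by (intro bounded_funs_mult bounded_funs_compose[of x \<Omega> _ fst] bounded_funs_compose[of y \<Omega> _ snd]) auto

lemma ip_tensor:
  assumes "x \<in> bounded_funs \<Omega>" "y \<in> bounded_funs \<Omega>" "z \<in> bounded_funs \<Omega>" "w \<in> bounded_funs \<Omega>"
  shows "J2.ip (tensor x y) (tensor z w) = ip x z * ip y w"
proof -
  have "J2.ip (tensor x y) (tensor z w) = J (\<lambda>a. J (\<lambda>b. (x a * z a) * (y b * w b)))"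
    by (simp add: J2.ip_def J2_def tensor_def mult_ac)
  also have "\<dots> = J (\<lambda>a. ip y w * (x a * z a))"
    using J_scale[OF bounded_funs_mult[OF assms(2,4)]] by (simp add: ip_def mult.commute[of "J _"])
  also have "\<dots> = ip x z * ip y w"
    using J_scale[OF bounded_funs_mult[OF assms(1,3)]] by (simp add: ip_def)
  finally show ?thesis .
qed

lemma nrm_tensor:
  assumes "x \<in> bounded_funs \<Omega>" "y \<in> bounded_funs \<Omega>"
  shows "J2.nrm (tensor x y) = nrm x * nrm y"
  using assms by (simp add: J2.nrm_def ip_tensor nrm_def real_sqrt_mult)

text \<open>The elements of finite rank. With lists a linear combination becomes a concatenation,
  the scalar being absorbed into the left factors.\<close>

definition tensors :: "(('a \<Rightarrow> real) \<times> ('a \<Rightarrow> real)) list \<Rightarrow> 'a \<times> 'a \<Rightarrow> real" where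
  "tensors xs = (\<lambda>p. \<Sum>(x, y)\<leftarrow>xs. tensor x y p)"

lemma tensors_bounded:
  "set xs \<subseteq> bounded_funs \<Omega> \<times> bounded_funs \<Omega> \<Longrightarrow> tensors xs \<in> bounded_funs (\<Omega> \<times> \<Omega>)"
proof (induction xs)
  case (Cons q xs)
  have eq: "tensors (q # xs) = (\<lambda>p. tensor (fst q) (snd q) p + tensors xs p)"
    by (auto simp: tensors_def split_beta)
  show ?case
    unfolding eq by (intro bounded_funs_add tensor_bounded) (use Cons in auto)
qed (simp add: tensors_def)

lemma ip_tensors:
  assumes "set xs \<subseteq> bounded_funs \<Omega> \<times> bounded_funs \<Omega>" "z \<in> bounded_funs \<Omega>" "w \<in> bounded_funs \<Omega>"
  shows "J2.ip (tensors xs) (tensor z w) = (\<Sum>(x, y)\<leftarrow>xs. ip x z * ip y w)"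
  using assms(1)
proof (induction xs)
  case Nil
  then show ?case by (simp add: tensors_def J2.ip_def J2.J_const)
next
  case (Cons q xs)
  have "tensors (q # xs) = (\<lambda>p. tensors xs p + 1 * tensor (fst q) (snd q) p)"
    by (auto simp: tensors_def split_beta)
  moreover have b: "tensors xs \<in> bounded_funs (\<Omega> \<times> \<Omega>)" "fst q \<in> bounded_funs \<Omega>" "snd q \<in> bounded_funs \<Omega>"
    using Cons.prems tensors_bounded[of xs] by auto
  ultimately have "J2.ip (tensor z w) (tensors (q # xs)) =
      J2.ip (tensor z w) (tensors xs) + 1 * J2.ip (tensor z w) (tensor (fst q) (snd q))"
    using J2.ip_lin[OF tensor_bounded[OF assms(2,3)] b(1) tensor_bounded[OF b(2,3)], of 1] by simp
  then show ?case
    using Cons b assms(2,3)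
    by (simp add: J2.ip_commute[of "tensor z w"] ip_tensor split_beta)
qed

lemma tensors_lin:
  "(\<lambda>p. tensors xs p + t * tensors ys p) = tensors (xs @ map (\<lambda>(x, y). (\<lambda>a. t * x a, y)) ys)"
proof
  fix p
  have "t * tensors ys p = tensors (map (\<lambda>(x, y). (\<lambda>a. t * x a, y)) ys) p"
    by (induction ys) (auto simp: tensors_def tensor_def algebra_simps)
  then show "tensors xs p + t * tensors ys p = tensors (xs @ map (\<lambda>(x, y). (\<lambda>a. t * x a, y)) ys) p"
    by (simp add: tensors_def)
qed

text \<open>
  The operator \<open>z \<mapsto> \<integral> \<langle>u h, z\<rangle> u h dI\<close> is Hilbert--Schmidt, since it is the weak average of the
  elements \<open>u h \<otimes> u h\<close> of the tensor square; the approximate Riesz representation in that space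
  therefore approximates it by operators of finite rank in operator norm.
\<close>

lemma finite_rank_approx:
  assumes I: "mean \<Gamma> I" and u: "\<And>h a. h \<in> \<Gamma> \<Longrightarrow> a \<in> \<Omega> \<Longrightarrow> \<bar>u h a\<bar> \<le> 1" and "\<epsilon> > 0"
  obtains xs where "set xs \<subseteq> bounded_funs \<Omega> \<times> bounded_funs \<Omega>"
    "\<And>z w. \<lbrakk>z \<in> bounded_funs \<Omega>; w \<in> bounded_funs \<Omega>\<rbrakk> \<Longrightarrow>
      \<bar>(\<Sum>(x, y)\<leftarrow>xs. ip x z * ip y w) - I (\<lambda>h. ip (u h) z * ip (u h) w)\<bar> \<le> \<epsilon> * (nrm z * nrm w)"
proof -
  interpret I: mean \<Gamma> I by (rule I)
  define S where "S = {tensors xs | xs. set xs \<subseteq> bounded_funs \<Omega> \<times> bounded_funs \<Omega>}"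
  define L where "L F = I (\<lambda>h. J2.ip (tensor (u h) (u h)) F)" for F
  have ub: "u h \<in> bounded_funs \<Omega>" if "h \<in> \<Gamma>" for h
    using u that by (intro bounded_funsI[of _ _ 1]) auto
  have S_sub: "S \<subseteq> bounded_funs (\<Omega> \<times> \<Omega>)" using tensors_bounded by (auto simp: S_def)
  have S_ne: "S \<noteq> {}" unfolding S_def by (auto intro: exI[of _ "[]"])
  have S_lin: "(\<lambda>p. F p + t * F' p) \<in> S" if F: "F \<in> S" "F' \<in> S" for F F' t
  proof -
    obtain xs where xs: "F = tensors xs" "set xs \<subseteq> bounded_funs \<Omega> \<times> bounded_funs \<Omega>"
      using F(1) by (auto simp: S_def)
    obtain ys where ys: "F' = tensors ys" "set ys \<subseteq> bounded_funs \<Omega> \<times> bounded_funs \<Omega>"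
      using F(2) by (auto simp: S_def)
    have "set (xs @ map (\<lambda>(x, y). (\<lambda>a. t * x a, y)) ys) \<subseteq> bounded_funs \<Omega> \<times> bounded_funs \<Omega>"
      using xs ys by auto
    then show ?thesis unfolding S_def xs(1) ys(1) tensors_lin by blast
  qed
  have bd: "\<bar>J2.ip (tensor (u h) (u h)) F\<bar> \<le> J2.nrm F" if "h \<in> \<Gamma>" "F \<in> bounded_funs (\<Omega> \<times> \<Omega>)" for h F
  proof -
    have "J2.nrm (tensor (u h) (u h)) \<le> 1"
      using nrm_le_1[OF u[OF that(1)]] ub[OF that(1)] by (simp add: nrm_tensor mult_le_one)
    then have "J2.nrm (tensor (u h) (u h)) * J2.nrm F \<le> 1 * J2.nrm F"
      using that(2) by (intro mult_right_mono) auto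
    then show ?thesis
      using J2.Cauchy_Schwarz[OF tensor_bounded[OF ub ub] that(2)] that(1) by fastforce
  qed
  have bb: "(\<lambda>h. J2.ip (tensor (u h) (u h)) F) \<in> bounded_funs \<Gamma>" if "F \<in> bounded_funs (\<Omega> \<times> \<Omega>)" for F
    using bd that by (intro bounded_funsI) auto
  have L_lin: "L (\<lambda>p. F p + t * F' p) = L F + t * L F'" if "F \<in> S" "F' \<in> S" for F F' t
  proof -
    have F: "F \<in> bounded_funs (\<Omega> \<times> \<Omega>)" "F' \<in> bounded_funs (\<Omega> \<times> \<Omega>)" using that S_sub by auto
    have "L (\<lambda>p. F p + t * F' p) =
        I (\<lambda>h. J2.ip (tensor (u h) (u h)) F + t * J2.ip (tensor (u h) (u h)) F')"
      unfolding L_def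
      by (rule I.J_cong) (use F ub in \<open>auto intro!: bb J2.ip_lin tensor_bounded\<close>)
    then show ?thesis
      unfolding L_def using F by (simp add: I.J_add I.J_scale bb bounded_funs_scale)
  qed
  have L_bd: "\<bar>L F\<bar> \<le> 1 * J2.nrm F" if "F \<in> S" for F
    unfolding L_def mult_1 by (rule I.J_abs_le) (use bd that S_sub in auto)
  obtain X where X: "X \<in> S"
    "\<And>F. F \<in> S \<Longrightarrow> \<bar>J2.ip X F - L F\<bar> \<le> \<epsilon> * J2.nrm F"
    using J2.approx_Riesz[OF S_sub S_ne S_lin L_lin L_bd \<open>\<epsilon> > 0\<close>] by metis
  obtain xs where xs: "X = tensors xs" "set xs \<subseteq> bounded_funs \<Omega> \<times> bounded_funs \<Omega>"
    using X(1) by (auto simp: S_def)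
  show thesis
  proof (rule that[OF xs(2)])
    fix z w assume zw: "z \<in> bounded_funs \<Omega>" "w \<in> bounded_funs \<Omega>"
    \<comment> \<open>Evaluated at a single tensor, whose norm is \<open>nrm z * nrm w\<close>, the
      Riesz estimate becomes an operator norm estimate.\<close>
    have "tensor z w = tensors [(z, w)]" by (simp add: tensors_def)
    then have "tensor z w \<in> S" using zw unfolding S_def by fastforce
    then have "\<bar>J2.ip X (tensor z w) - L (tensor z w)\<bar> \<le> \<epsilon> * J2.nrm (tensor z w)" by (rule X(2))
    moreover have "L (tensor z w) = I (\<lambda>h. ip (u h) z * ip (u h) w)"
      unfolding L_def
      by (rule I.J_cong) (use zw ub in \<open>auto intro!: bb tensor_bounded ip_tensor\<close>)
    ultimately show "\<bar>(\<Sum>(x, y)\<leftarrow>xs. ip x z * ip y w) - I (\<lambda>h. ip (u h) z * ip (u h) w)\<bar>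
        \<le> \<epsilon> * (nrm z * nrm w)"
      using zw xs by (simp add: ip_tensors nrm_tensor)
  qed
qed

end

section \<open>Almost periodic functionals\<close>

text \<open>The definition of \<open>almost_periodic\<close> needs one fixed type of colours. This
  lemma allows the proofs to colour by pairs, lists or functions.\<close>

lemma finite_coloring_nat:
  assumes "finite (c ` S)"
  obtains c' :: "'a \<Rightarrow> nat" where "finite (c' ` S)" "\<And>g h. g \<in> S \<Longrightarrow> h \<in> S \<Longrightarrow> c' g = c' h \<Longrightarrow> c g = c h"
proof -
  obtain i :: "'b \<Rightarrow> nat" where i: "inj_on i (c ` S)"
    using finite_imp_inj_to_nat_seg[OF assms] by blast
  show thesis
  proof (rule that[of "i \<circ> c"])
    show "finite ((i \<circ> c) ` S)" using finite_imageI[OF assms, of i] by (simp add: image_image)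
  qed (use i in \<open>auto dest: inj_onD\<close>)
qed

locale inv_mean = group G + mean "carrier G" J for G :: "('g, 'm) monoid_scheme" (structure) and J +
  assumes J_inv: "\<lbrakk>g \<in> carrier G; f \<in> bounded_funs (carrier G)\<rbrakk> \<Longrightarrow> J (\<lambda>a. f (g \<otimes> a)) = J f"
begin

abbreviation B :: "('g \<Rightarrow> real) set" where "B \<equiv> bounded_funs (carrier G)"

text \<open>This is translation by \<open>inv g\<close>, hence composition reverses the order of the
  group elements.\<close>

definition shift :: "'g \<Rightarrow> ('g \<Rightarrow> real) \<Rightarrow> 'g \<Rightarrow> real" where
  "shift g y = (\<lambda>a. y (g \<otimes> a))"

lemma shift_bounded [simp, intro]: "g \<in> carrier G \<Longrightarrow> y \<in> B \<Longrightarrow> shift g y \<in> B"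
  unfolding shift_def by (rule bounded_funs_compose) auto

lemma shift_shift:
  "\<lbrakk>g \<in> carrier G; h \<in> carrier G; a \<in> carrier G\<rbrakk> \<Longrightarrow> shift g (shift h y) a = shift (h \<otimes> g) y a"
  by (simp add: shift_def m_assoc)

lemma shift_one: "a \<in> carrier G \<Longrightarrow> shift \<one> y a = y a"
  by (simp add: shift_def)

lemma ip_cong:
  assumes "x \<in> B" "y \<in> B" "\<And>a. a \<in> carrier G \<Longrightarrow> x a = x' a" "\<And>a. a \<in> carrier G \<Longrightarrow> y a = y' a"
  shows "ip x y = ip x' y'"
  unfolding ip_def by (rule J_cong) (use assms in auto)

lemma ip_shift: "\<lbrakk>g \<in> carrier G; x \<in> B; y \<in> B\<rbrakk> \<Longrightarrow> ip (shift g x) (shift g y) = ip x y"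
  unfolding ip_def shift_def using J_inv[of g "\<lambda>a. x a * y a"] by auto

lemma nrm_shift [simp]: "\<lbrakk>g \<in> carrier G; x \<in> B\<rbrakk> \<Longrightarrow> nrm (shift g x) = nrm x"
  by (simp add: nrm_def ip_shift)

lemma ip_shift_inv:
  assumes "g \<in> carrier G" "x \<in> B" "y \<in> B"
  shows "ip (shift (inv g) x) y = ip x (shift g y)"
proof -
  have "ip (shift (inv g) x) y = ip (shift g (shift (inv g) x)) (shift g y)"
    using assms by (simp add: ip_shift)
  also have "\<dots> = ip x (shift g y)"
    by (rule ip_cong) (use assms shift_shift[of g "inv g" _ x] shift_one[of _ x] in auto)
  finally show ?thesis .
qed

lemma functional_shift:
  assumes "functional C w" "g \<in> carrier G"
  shows "functional C (\<lambda>y. w (shift g y))"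
proof -
  have "shift g (\<lambda>a. x a + t * y a) = (\<lambda>a. shift g x a + t * shift g y a)" for x y t
    by (simp add: shift_def)
  then show ?thesis
    using assms functional_bound[OF assms(1) shift_bounded[OF assms(2)]]
    unfolding functional_def by simp
qed

text \<open>
  Total boundedness of the orbit of \<open>w\<close> in the dual norm, expressed by finite colourings rather
  than finite nets.
\<close>

definition almost_periodic :: "(('g \<Rightarrow> real) \<Rightarrow> real) \<Rightarrow> bool" where
  "almost_periodic w \<longleftrightarrow> (\<exists>C. functional C w) \<and>
     (\<forall>\<epsilon>>0. \<exists>c :: 'g \<Rightarrow> nat. finite (c ` carrier G) \<and>
        (\<forall>g\<in>carrier G. \<forall>h\<in>carrier G. c g = c h \<longrightarrow> functional \<epsilon> (\<lambda>y. w (shift g y) - w (shift h y))))"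

lemma almost_periodicE:
  assumes "almost_periodic w" "\<epsilon> > 0"
  obtains c :: "'g \<Rightarrow> nat" where "finite (c ` carrier G)"
    "\<And>g h. \<lbrakk>g \<in> carrier G; h \<in> carrier G; c g = c h\<rbrakk> \<Longrightarrow> functional \<epsilon> (\<lambda>y. w (shift g y) - w (shift h y))"
  using assms unfolding almost_periodic_def by metis

text \<open>Colours may have any type here, and only the norm estimate is required: linearity of the
  differences is inherited from \<open>w\<close>.\<close>

lemma almost_periodicI:
  assumes w: "functional C w"
    and "\<And>\<epsilon>. \<epsilon> > 0 \<Longrightarrow> \<exists>c :: 'g \<Rightarrow> 'c. finite (c ` carrier G) \<and>
      (\<forall>g\<in>carrier G. \<forall>h\<in>carrier G. c g = c h \<longrightarrow>
        (\<forall>y\<in>B. \<bar>w (shift g y) - w (shift h y)\<bar> \<le> \<epsilon> * nrm y))"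
  shows "almost_periodic w"
  unfolding almost_periodic_def
proof (intro conjI allI impI exI[of _ C] w)
  fix \<epsilon> :: real assume "\<epsilon> > 0"
  then obtain c :: "'g \<Rightarrow> 'c" where c: "finite (c ` carrier G)"
    "\<And>g h y. \<lbrakk>g\<in>carrier G; h\<in>carrier G; c g = c h; y \<in> B\<rbrakk> \<Longrightarrow>
        \<bar>w (shift g y) - w (shift h y)\<bar> \<le> \<epsilon> * nrm y" using assms(2) by metis
  obtain c' :: "'g \<Rightarrow> nat" where c': "finite (c' ` carrier G)"
      "\<And>g h. g \<in> carrier G \<Longrightarrow> h \<in> carrier G \<Longrightarrow> c' g = c' h \<Longrightarrow> c g = c h"
    using finite_coloring_nat[OF c(1)] by metis
  have "functional \<epsilon> (\<lambda>y. w (shift g y) - w (shift h y))"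
    if g: "g \<in> carrier G" and h: "h \<in> carrier G" and "c' g = c' h" for g h
  proof -
    have "\<bar>w (shift g y) - w (shift h y)\<bar> \<le> \<epsilon> * nrm y" if "y \<in> B" for y
      using c c' that g h \<open>c' g = c' h\<close> by blast
    moreover have "functional (C + \<bar>-1\<bar> * C) (\<lambda>y. w (shift g y) + (-1) * w (shift h y))"
      by (intro functional_comb functional_shift w g h)
    ultimately show ?thesis unfolding functional_def by simp
  qed
  then show "\<exists>c :: 'g \<Rightarrow> nat. finite (c ` carrier G) \<and>
      (\<forall>g\<in>carrier G. \<forall>h\<in>carrier G. c g = c h \<longrightarrow> functional \<epsilon> (\<lambda>y. w (shift g y) - w (shift h y)))"
    using c'(1) by blast
qed

lemma functional_minus:
  assumes "functional C x" "functional D y"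
  shows "functional (C + D) (\<lambda>z. x z - y z)"
  using functional_comb[OF assms, of "-1"] by simp

lemma almost_periodic_comb:
  assumes x: "almost_periodic x" and y: "almost_periodic y"
  shows "almost_periodic (\<lambda>z. x z + t * y z)"
proof -
  obtain C D where "functional C x" "functional D y"
    using x y unfolding almost_periodic_def by blast
  then have "functional (C + \<bar>t\<bar> * D) (\<lambda>z. x z + t * y z)" by (rule functional_comb)
  then show ?thesis
  proof (rule almost_periodicI)
    fix \<epsilon> :: real assume "\<epsilon> > 0"
    define d where "d = \<epsilon> / (\<bar>t\<bar> + 1)"
    have d: "d > 0" "d + \<bar>t\<bar> * d = \<epsilon>"
    proof -
      have "(\<bar>t\<bar> + 1) * d = \<epsilon>" by (simp add: d_def)
      then show "d + \<bar>t\<bar> * d = \<epsilon>" by (simp add: algebra_simps)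
    qed (use \<open>\<epsilon> > 0\<close> in \<open>simp add: d_def add_nonneg_pos\<close>)
    obtain c1 :: "'g \<Rightarrow> nat" where c1: "finite (c1 ` carrier G)"
      "\<And>g h. \<lbrakk>g \<in> carrier G; h \<in> carrier G; c1 g = c1 h\<rbrakk> \<Longrightarrow> functional d (\<lambda>z. x (shift g z) - x (shift h z))"
      using almost_periodicE[OF x d(1)] by blast
    obtain c2 :: "'g \<Rightarrow> nat" where c2: "finite (c2 ` carrier G)"
      "\<And>g h. \<lbrakk>g \<in> carrier G; h \<in> carrier G; c2 g = c2 h\<rbrakk> \<Longrightarrow> functional d (\<lambda>z. y (shift g z) - y (shift h z))"
      using almost_periodicE[OF y d(1)] by blast
    let ?c = "\<lambda>g. (c1 g, c2 g)"
    have "?c ` carrier G \<subseteq> c1 ` carrier G \<times> c2 ` carrier G" by auto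
    then have "finite (?c ` carrier G)" by (rule finite_subset) (use c1 c2 in auto)
    moreover have "\<bar>x (shift g z) + t * y (shift g z) - (x (shift h z) + t * y (shift h z))\<bar> \<le> \<epsilon> * nrm z"
      if gh: "g \<in> carrier G" "h \<in> carrier G" "?c g = ?c h" and z: "z \<in> B" for g h z
    proof -
      have "functional (d + \<bar>t\<bar> * d)
          (\<lambda>z. (x (shift g z) - x (shift h z)) + t * (y (shift g z) - y (shift h z)))"
        using gh by (intro functional_comb c1 c2) auto
      from functional_bound[OF this z] show ?thesis unfolding d(2) by (simp add: algebra_simps)
    qed
    ultimately show "\<exists>c :: 'g \<Rightarrow> nat \<times> nat. finite (c ` carrier G) \<and>
      (\<forall>g\<in>carrier G. \<forall>h\<in>carrier G. c g = c h \<longrightarrow> (\<forall>z\<in>B.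
        \<bar>x (shift g z) + t * y (shift g z) - (x (shift h z) + t * y (shift h z))\<bar> \<le> \<epsilon> * nrm z))"
      by blast
  qed
qed

text \<open>A colouring that works for a close enough \<open>z\<close> works for \<open>x\<close>,
  by the usual three term estimate.\<close>

lemma almost_periodic_limit:
  assumes x: "functional C x"
    and lim: "\<And>\<epsilon>. \<epsilon> > 0 \<Longrightarrow> \<exists>z. almost_periodic z \<and> functional \<epsilon> (\<lambda>y. x y - z y)"
  shows "almost_periodic x"
  using x
proof (rule almost_periodicI)
  fix \<epsilon> :: real assume "\<epsilon> > 0"
  then have e: "\<epsilon> / 3 > 0" by simp
  obtain z where z: "almost_periodic z" and xz: "functional (\<epsilon> / 3) (\<lambda>y. x y - z y)"
    using lim[OF e] by blast
  obtain c :: "'g \<Rightarrow> nat" where c: "finite (c ` carrier G)"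
    "\<And>g h. \<lbrakk>g \<in> carrier G; h \<in> carrier G; c g = c h\<rbrakk> \<Longrightarrow> functional (\<epsilon> / 3) (\<lambda>y. z (shift g y) - z (shift h y))"
    using almost_periodicE[OF z e] by blast
  have "\<bar>x (shift g y) - x (shift h y)\<bar> \<le> \<epsilon> * nrm y"
    if gh: "g \<in> carrier G" "h \<in> carrier G" "c g = c h" and y: "y \<in> B" for g h y
    using functional_bound[OF functional_shift[OF xz gh(1)] y] functional_bound[OF functional_shift[OF xz gh(2)] y]
      functional_bound[OF c(2)[OF gh] y] by linarith
  then show "\<exists>c :: 'g \<Rightarrow> nat. finite (c ` carrier G) \<and> (\<forall>g\<in>carrier G. \<forall>h\<in>carrier G. c g = c h \<longrightarrow>
      (\<forall>y\<in>B. \<bar>x (shift g y) - x (shift h y)\<bar> \<le> \<epsilon> * nrm y))"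
    using c(1) by blast
qed

text \<open>\<open>J\<close> is the functional of the constant function 1, which every shift fixes,
  so one colour suffices.\<close>

lemma almost_periodic_J: "almost_periodic J"
proof -
  have eq: "ip (\<lambda>_. 1) = J" by (simp add: ip_def fun_eq_iff)
  have "functional (nrm (\<lambda>_. 1)) J" using functional_ip[of "\<lambda>_. 1"] by (simp add: eq)
  then show ?thesis
  proof (rule almost_periodicI)
    fix \<epsilon> :: real assume "\<epsilon> > 0"
    then show "\<exists>c :: 'g \<Rightarrow> nat. finite (c ` carrier G) \<and> (\<forall>g\<in>carrier G. \<forall>h\<in>carrier G. c g = c h \<longrightarrow>
        (\<forall>y\<in>B. \<bar>J (shift g y) - J (shift h y)\<bar> \<le> \<epsilon> * nrm y))"
      by (intro exI[of _ "\<lambda>_. 0"]) (auto simp: shift_def J_inv image_constant_conv)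
  qed
qed

text \<open>The translate of \<open>v\<close> by \<open>h\<close>: the indicator function of
  \<open>A\<close> becomes that of \<open>h <# A\<close>.\<close>

definition orbit :: "('g \<Rightarrow> real) \<Rightarrow> 'g \<Rightarrow> 'g \<Rightarrow> real" where
  "orbit v h = shift (inv h) v"

text \<open>With \<open>w = \<langle>W, \<cdot>\<rangle>\<close> this is \<open>\<langle>T W, \<cdot>\<rangle>\<close> for the operator \<open>T W = \<integral> \<langle>W, h v\<rangle> h v dI(h)\<close>.\<close>

definition avg :: "(('g \<Rightarrow> real) \<Rightarrow> real) \<Rightarrow> ('g \<Rightarrow> real) \<Rightarrow> (('g \<Rightarrow> real) \<Rightarrow> real) \<Rightarrow> ('g \<Rightarrow> real) \<Rightarrow> real" where
  "avg I v w y = I (\<lambda>h. w (orbit v h) * ip (orbit v h) y)"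

section \<open>The averaging operator of an invariant mean \<open>I\<close> that may differ from
  \<open>J\<close>\<close>

context
  fixes I :: "('g \<Rightarrow> real) \<Rightarrow> real" and v :: "'g \<Rightarrow> real"
  assumes I: "inv_mean G I" and v: "\<And>a. a \<in> carrier G \<Longrightarrow> \<bar>v a\<bar> \<le> 1"
begin

interpretation I: inv_mean G I by (rule I)

lemma v_bounded [simp, intro]: "v \<in> B"
  using v by (rule bounded_funsI)

lemma orbit_bounded [simp, intro]: "h \<in> carrier G \<Longrightarrow> orbit v h \<in> B"
  by (auto simp: orbit_def)

lemma orbit_le_1: "\<lbrakk>h \<in> carrier G; a \<in> carrier G\<rbrakk> \<Longrightarrow> \<bar>orbit v h a\<bar> \<le> 1"
  unfolding orbit_def shift_def by (rule v) auto

lemma nrm_orbit: "h \<in> carrier G \<Longrightarrow> nrm (orbit v h) \<le> 1"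
  by (rule nrm_le_1) (rule orbit_le_1)

lemma functional_orbit:
  assumes "functional C w" "h \<in> carrier G"
  shows "\<bar>w (orbit v h)\<bar> \<le> C"
  using functional_bound[OF assms(1) orbit_bounded[OF assms(2)]]
    mult_left_mono[OF nrm_orbit[OF assms(2)] functional_nonneg[OF assms(1)]] by simp

lemma ip_orbit: "\<lbrakk>h \<in> carrier G; y \<in> B\<rbrakk> \<Longrightarrow> \<bar>ip (orbit v h) y\<bar> \<le> nrm y"
  using Cauchy_Schwarz[OF orbit_bounded, of h y] mult_right_mono[OF nrm_orbit, of h "nrm y"] by simp

lemma functional_orbit_bounded: "functional C w \<Longrightarrow> (\<lambda>h. w (orbit v h)) \<in> B"
  by (rule bounded_funsI) (rule functional_orbit)

lemma ip_orbit_bounded: "y \<in> B \<Longrightarrow> (\<lambda>h. ip (orbit v h) y) \<in> B"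
  by (rule bounded_funsI) (rule ip_orbit)

lemma avg_integrand_bounded:
  "\<lbrakk>functional C w; y \<in> B\<rbrakk> \<Longrightarrow> (\<lambda>h. w (orbit v h) * ip (orbit v h) y) \<in> B"
  by (intro bounded_funs_mult functional_orbit_bounded ip_orbit_bounded)

lemma functional_avg:
  assumes w: "functional C w"
  shows "functional C (avg I v w)"
  unfolding functional_def
proof (intro conjI ballI allI)
  fix x y t assume x: "x \<in> B" and y: "y \<in> B"
  have "avg I v w (\<lambda>a. x a + t * y a) =
      I (\<lambda>h. w (orbit v h) * ip (orbit v h) x + t * (w (orbit v h) * ip (orbit v h) y))"
    unfolding avg_def
    by (rule I.J_cong[OF avg_integrand_bounded[OF w]])
       (use x y in \<open>auto simp: ip_lin algebra_simps\<close>)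
  then show "avg I v w (\<lambda>a. x a + t * y a) = avg I v w x + t * avg I v w y"
    unfolding avg_def
    using avg_integrand_bounded[OF w x] avg_integrand_bounded[OF w y]
    by (simp add: I.J_add I.J_scale bounded_funs_scale)
next
  fix y assume y: "y \<in> B"
  show "\<bar>avg I v w y\<bar> \<le> C * nrm y"
    unfolding avg_def
    by (rule I.J_abs_le)
       (use w y functional_orbit ip_orbit functional_nonneg in \<open>auto simp: abs_mult intro!: mult_mono\<close>)
qed

text \<open>The averaging operator commutes with the group action: substitute
  \<open>g \<otimes> h\<close> for \<open>h\<close>. This is where the invariance of
  \<open>I\<close> enters.\<close>

lemma avg_shift:
  assumes w: "functional C w" and g: "g \<in> carrier G" and y: "y \<in> B"
  shows "avg I v w (shift g y) = avg I v (\<lambda>z. w (shift g z)) y"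
proof -
  let ?F = "\<lambda>h. w (shift g (orbit v h)) * ip (orbit v h) y"
  have F: "?F \<in> B"
    using avg_integrand_bounded[OF functional_shift[OF w g] y] by simp
  have "I (\<lambda>h. ?F (g \<otimes> h)) = I ?F" using F g by (rule I.J_inv[rotated])
  moreover have "I (\<lambda>h. ?F (g \<otimes> h)) = I (\<lambda>h. w (orbit v h) * ip (orbit v h) (shift g y))"
  proof (rule I.J_cong)
    show "(\<lambda>h. ?F (g \<otimes> h)) \<in> B"
      using bounded_funs_compose[OF F, of "carrier G" "\<lambda>h. g \<otimes> h"] g by auto
    fix h assume h: "h \<in> carrier G"
    have eq: "shift g (orbit v (g \<otimes> h)) a = orbit v h a" if "a \<in> carrier G" for a
    proof -
      have "inv h \<otimes> inv g \<otimes> g = inv h" using g h by (simp add: m_assoc)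
      then show ?thesis using g h that shift_shift[of g "inv (g \<otimes> h)" a v]
        by (simp add: orbit_def inv_mult_group)
    qed
    have "w (shift g (orbit v (g \<otimes> h))) = w (orbit v h)"
      by (rule functional_cong[OF w]) (use g h eq in auto)
    moreover have "ip (orbit v (g \<otimes> h)) y = ip (shift g (orbit v (g \<otimes> h))) (shift g y)"
      using g h y by (simp add: ip_shift)
    moreover have "ip (shift g (orbit v (g \<otimes> h))) (shift g y) = ip (orbit v h) (shift g y)"
      by (rule ip_cong) (use g h y eq in auto)
    ultimately show "?F (g \<otimes> h) = w (orbit v h) * ip (orbit v h) (shift g y)" by simp
  qed
  ultimately show ?thesis by (simp add: avg_def)
qed

text \<open>Up to \<open>\<epsilon> / 3\<close> the shifted functional is given by an operator of
  finite rank, and then \<open>g\<close> enters only through the finitely many coefficients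
  \<open>ip p (Wg g)\<close>. These are bounded uniformly in \<open>g\<close>, so rounding them
  gives a finite colouring.\<close>

lemma almost_periodic_avg:
  assumes w: "functional C w"
  shows "almost_periodic (avg I v w)"
  using functional_avg[OF w]
proof (rule almost_periodicI)
  fix \<epsilon> :: real assume \<epsilon>: "\<epsilon> > 0"
  have C: "C \<ge> 0" using functional_nonneg[OF w] .
  \<comment> \<open>\<open>e1\<close> pays for replacing \<open>w\<close> by a vector and
    \<open>e2\<close> for the finite rank approximation; each costs at most
    \<open>\<epsilon> / 6 * nrm y\<close>. The bound \<open>e1 \<le> 1\<close> keeps the norm of
    that vector below \<open>C + 1\<close>.\<close>
  define e1 where "e1 = min 1 (\<epsilon> / 6)"
  define e2 where "e2 = \<epsilon> / 6 / (C + 1)"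
  have e1: "e1 > 0" "e1 \<le> 1" "6 * e1 \<le> \<epsilon>" using \<epsilon> by (auto simp: e1_def)
  have e2: "e2 > 0" "e2 * (C + 1) = \<epsilon> / 6"
    using \<epsilon> C nonzero_divide_eq_eq[of "C + 1" "\<epsilon> / 6" e2] by (simp_all add: e2_def add_nonneg_pos)
  obtain W where W: "W \<in> B" "functional e1 (\<lambda>y. ip W y - w y)" "nrm W \<le> C + e1"
    using functional_approx[OF w e1(1)] by metis
  obtain xs where xs: "set xs \<subseteq> B \<times> B"
    "\<And>z y. \<lbrakk>z \<in> B; y \<in> B\<rbrakk> \<Longrightarrow> \<bar>(\<Sum>(p, q)\<leftarrow>xs. ip p z * ip q y) - I (\<lambda>h. ip (orbit v h) z * ip (orbit v h) y)\<bar>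
      \<le> e2 * (nrm z * nrm y)"
    using finite_rank_approx[where u = "orbit v", OF I.mean_axioms orbit_le_1 e2(1)] by blast
  \<comment> \<open>As \<open>W\<close> represents \<open>w\<close> up to \<open>e1\<close>, the
    vector \<open>Wg g\<close> represents \<open>\<lambda>y. w (shift g y)\<close> up to
    \<open>e1\<close>.\<close>
  define Wg where "Wg g = shift (inv g) W" for g
  have Wg: "Wg g \<in> B" "nrm (Wg g) \<le> C + 1" if "g \<in> carrier G" for g
    using that W e1 by (auto simp: Wg_def)
  have est: "\<bar>avg I v w (shift g y) - (\<Sum>(p, q)\<leftarrow>xs. ip p (Wg g) * ip q y)\<bar> \<le> \<epsilon> / 3 * nrm y"
    if g: "g \<in> carrier G" and y: "y \<in> B" for g y
  proof -
    have ny: "nrm y \<ge> 0" using y by simp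
    have eq: "avg I v w (shift g y) = I (\<lambda>h. w (shift g (orbit v h)) * ip (orbit v h) y)"
      unfolding avg_shift[OF w g y] by (simp add: avg_def)
    have "\<bar>avg I v w (shift g y) - I (\<lambda>h. ip (orbit v h) (Wg g) * ip (orbit v h) y)\<bar> \<le> e1 * nrm y"
      unfolding eq
    proof (rule I.J_diff_abs_le)
      show "(\<lambda>h. w (shift g (orbit v h)) * ip (orbit v h) y) \<in> B"
        using avg_integrand_bounded[OF functional_shift[OF w g] y] by simp
      show "(\<lambda>h. ip (orbit v h) (Wg g) * ip (orbit v h) y) \<in> B"
        using g y by (intro bounded_funs_mult ip_orbit_bounded Wg)
      fix h assume h: "h \<in> carrier G"
      have "ip (orbit v h) (Wg g) = ip W (shift g (orbit v h))"
        using g h W by (subst ip_commute) (simp add: Wg_def ip_shift_inv)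
      then have "\<bar>w (shift g (orbit v h)) - ip (orbit v h) (Wg g)\<bar> \<le> e1"
        using functional_orbit[OF functional_shift[OF W(2) g] h] by simp
      then have "\<bar>w (shift g (orbit v h)) - ip (orbit v h) (Wg g)\<bar> * \<bar>ip (orbit v h) y\<bar> \<le> e1 * nrm y"
        using ip_orbit[OF h y] e1 by (intro mult_mono) auto
      then show "\<bar>w (shift g (orbit v h)) * ip (orbit v h) y - ip (orbit v h) (Wg g) * ip (orbit v h) y\<bar>
          \<le> e1 * nrm y"
        by (simp flip: abs_mult left_diff_distrib)
    qed
    moreover have "e2 * (nrm (Wg g) * nrm y) \<le> \<epsilon> / 6 * nrm y"
      unfolding e2(2)[symmetric] mult.assoc
      using Wg[OF g] e2(1) ny by (intro mult_left_mono mult_right_mono) auto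
    moreover have "e1 * nrm y \<le> \<epsilon> / 6 * nrm y" using e1 ny by (intro mult_right_mono) auto
    ultimately show ?thesis using xs(2)[OF Wg(1)[OF g] y] by linarith
  qed
  define M where "M = (\<Sum>(p, q)\<leftarrow>xs. nrm q)"
  have M: "M \<ge> 0" unfolding M_def using xs(1) by (intro sum_list_nonneg) auto
  \<comment> \<open>Coefficients of equal colour differ by at most \<open>d\<close>, so the finite
    sums differ by at most \<open>d * M * nrm y\<close>.\<close>
  define d where "d = \<epsilon> / 3 / (M + 1)"
  have d: "d > 0" "d * M \<le> \<epsilon> / 3"
  proof -
    have "d * (M + 1) = \<epsilon> / 3"
      using M nonzero_divide_eq_eq[of "M + 1" "\<epsilon> / 3" d] by (simp add: d_def)
    moreover show "d > 0" using M \<epsilon> by (simp add: d_def)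
    ultimately show "d * M \<le> \<epsilon> / 3" by (simp add: distrib_left)
  qed
  define c where "c g = map (\<lambda>(p, q). \<lfloor>ip p (Wg g) / d\<rfloor>) xs" for g
  have "finite (c ` carrier G)"
  proof -
    define K where "K = (\<Union>(p, q)\<in>set xs. {\<lfloor>- (nrm p * (C + 1)) / d\<rfloor>..\<lfloor>nrm p * (C + 1) / d\<rfloor>})"
    have "c ` carrier G \<subseteq> {l. set l \<subseteq> K \<and> length l = length xs}"
    proof safe
      fix g k assume g: "g \<in> carrier G" and "k \<in> set (c g)"
      then obtain p q where pq: "(p, q) \<in> set xs" "k = \<lfloor>ip p (Wg g) / d\<rfloor>"
        by (auto simp: c_def)
      have "p \<in> B" using xs(1) pq by auto
      have "\<bar>ip p (Wg g)\<bar> \<le> nrm p * nrm (Wg g)"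
        using \<open>p \<in> B\<close> Wg[OF g] by (intro Cauchy_Schwarz)
      also have "\<dots> \<le> nrm p * (C + 1)"
        using \<open>p \<in> B\<close> Wg[OF g] by (intro mult_left_mono) auto
      finally have "- (nrm p * (C + 1)) \<le> ip p (Wg g)" "ip p (Wg g) \<le> nrm p * (C + 1)"
        by linarith+
      then have "- (nrm p * (C + 1)) / d \<le> ip p (Wg g) / d" "ip p (Wg g) / d \<le> nrm p * (C + 1) / d"
        using d(1) by (intro divide_right_mono; simp)+
      then have "k \<in> {\<lfloor>- (nrm p * (C + 1)) / d\<rfloor>..\<lfloor>nrm p * (C + 1) / d\<rfloor>}"
        unfolding pq(2) by (auto intro: floor_mono)
      then show "k \<in> K" unfolding K_def using pq(1) by blast
    qed (simp add: c_def)
    moreover have "finite K" unfolding K_def by auto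
    ultimately show ?thesis using finite_lists_length_eq finite_subset by blast
  qed
  moreover have "\<bar>avg I v w (shift g y) - avg I v w (shift h y)\<bar> \<le> \<epsilon> * nrm y"
    if gh: "g \<in> carrier G" "h \<in> carrier G" "c g = c h" and y: "y \<in> B" for g h y
  proof -
    have ny: "nrm y \<ge> 0" using y by simp
    have summand: "\<bar>ip p (Wg g) * ip q y - ip p (Wg h) * ip q y\<bar> \<le> d * nrm q * nrm y"
      if "(p, q) \<in> set xs" for p q
    proof -
      have fl: "\<lfloor>ip p (Wg g) / d\<rfloor> = \<lfloor>ip p (Wg h) / d\<rfloor>"
        using gh(3) that unfolding c_def by (auto simp: map_eq_conv)
      have "\<bar>ip p (Wg g) / d - ip p (Wg h) / d\<bar> \<le> 1"
        using fl by linarith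
      then have "\<bar>ip p (Wg g) - ip p (Wg h)\<bar> \<le> d"
        using d(1) by (simp add: diff_divide_distrib[symmetric] abs_divide divide_le_eq)
      moreover have "\<bar>ip q y\<bar> \<le> nrm q * nrm y"
        using xs(1) that y by (intro Cauchy_Schwarz) auto
      ultimately have "\<bar>ip p (Wg g) - ip p (Wg h)\<bar> * \<bar>ip q y\<bar> \<le> d * (nrm q * nrm y)"
        using d(1) by (intro mult_mono) auto
      then show ?thesis by (simp add: mult.assoc flip: abs_mult left_diff_distrib)
    qed
    have "\<bar>(\<Sum>(p, q)\<leftarrow>ys. ip p (Wg g) * ip q y) - (\<Sum>(p, q)\<leftarrow>ys. ip p (Wg h) * ip q y)\<bar>
        \<le> d * (\<Sum>(p, q)\<leftarrow>ys. nrm q) * nrm y" if "set ys \<subseteq> set xs" for ys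
      using that
    proof (induction ys)
      case (Cons r ys)
      obtain p q where r: "r = (p, q)" by force
      show ?case using Cons summand[of p q] unfolding r by (simp add: algebra_simps)
    qed simp
    from this[OF subset_refl] have "\<bar>(\<Sum>(p, q)\<leftarrow>xs. ip p (Wg g) * ip q y) - (\<Sum>(p, q)\<leftarrow>xs. ip p (Wg h) * ip q y)\<bar>
        \<le> d * M * nrm y" by (simp add: M_def)
    also have "\<dots> \<le> \<epsilon> / 3 * nrm y" using d ny by (intro mult_right_mono)
    finally show ?thesis using est[OF gh(1) y] est[OF gh(2) y] by linarith
  qed
  ultimately show "\<exists>c :: 'g \<Rightarrow> int list. finite (c ` carrier G) \<and> (\<forall>g\<in>carrier G. \<forall>h\<in>carrier G. c g = c h \<longrightarrow>
      (\<forall>y\<in>B. \<bar>avg I v w (shift g y) - avg I v w (shift h y)\<bar> \<le> \<epsilon> * nrm y))"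
    by blast
qed

end

section \<open>The projection onto almost periodic functionals\<close>

text \<open>The distance, in the dual norm, from the functional \<open>ip v\<close> to the subspace
  of almost periodic functionals.\<close>

definition ap_dist :: "('g \<Rightarrow> real) \<Rightarrow> real" where
  "ap_dist v = Inf {C. \<exists>x. almost_periodic x \<and> functional C (\<lambda>y. ip v y - x y)}"

lemma functional_eq:
  assumes "functional C w" "\<And>y. y \<in> B \<Longrightarrow> w' y = w y"
  shows "functional C w'"
proof -
  have "(\<lambda>a. x a + t * y a) \<in> B" if "x \<in> B" "y \<in> B" for x y t
    using that by (intro bounded_funs_add bounded_funs_scale)
  then show ?thesis using assms unfolding functional_def by metis
qed

lemma almost_periodic_zero: "almost_periodic (\<lambda>_. 0)"
  using almost_periodic_comb[OF almost_periodic_J almost_periodic_J, of "-1"] by simp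

lemma ap_dist_bdd: "bdd_below {C. \<exists>x. almost_periodic x \<and> functional C (\<lambda>y. ip v y - x y)}"
  by (rule bdd_belowI[of _ 0]) (auto dest: functional_nonneg)

lemma ap_dist_le:
  assumes "almost_periodic x" "functional C (\<lambda>y. ip v y - x y)"
  shows "ap_dist v \<le> C"
  unfolding ap_dist_def by (rule cInf_lower[OF _ ap_dist_bdd]) (use assms in blast)

lemma ap_dist_nonempty:
  "v \<in> B \<Longrightarrow> {C. \<exists>x. almost_periodic x \<and> functional C (\<lambda>y. ip v y - x y)} \<noteq> {}"
  using almost_periodic_zero functional_ip[of v] by (auto intro!: exI[of _ "nrm v"] exI[of _ "\<lambda>_. 0"])

lemma ap_dist_nonneg: "v \<in> B \<Longrightarrow> 0 \<le> ap_dist v"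
  unfolding ap_dist_def by (rule cInf_greatest[OF ap_dist_nonempty]) (auto dest: functional_nonneg)

lemma ap_dist_near:
  assumes "v \<in> B" "e > 0"
  obtains x where "almost_periodic x" "functional (ap_dist v + e) (\<lambda>y. ip v y - x y)"
proof -
  have "\<exists>C\<in>{C. \<exists>x. almost_periodic x \<and> functional C (\<lambda>y. ip v y - x y)}. C < ap_dist v + e"
    unfolding ap_dist_def by (rule cInf_lessD[OF ap_dist_nonempty]) (use assms in auto)
  then obtain C x where "C < ap_dist v + e" "almost_periodic x" "functional C (\<lambda>y. ip v y - x y)"
    by blast
  then show thesis using that functional_mono[of C _ "ap_dist v + e"] by simp
qed

text \<open>The remainder \<open>w\<close> competes in the infimum and has dual norm at most
  \<open>nrm W + \<epsilon>\<close>. Distances are thereby bounded by norms of vectors, which can be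
  expanded as quadratic expressions.\<close>

lemma ap_dist_le_nrm:
  assumes ap: "almost_periodic (\<lambda>y. ip v y - w y)" and W: "W \<in> B" "functional \<epsilon> (\<lambda>y. ip W y - w y)"
  shows "ap_dist v \<le> nrm W + \<epsilon>"
proof (rule ap_dist_le[OF ap])
  have "functional (nrm W + \<epsilon>) (\<lambda>y. ip W y - (ip W y - w y))"
    using functional_minus[OF functional_ip[OF W(1)] W(2)] .
  then show "functional (nrm W + \<epsilon>) (\<lambda>y. ip v y - (ip v y - w y))" by simp
qed

text \<open>Since \<open>avg I v w\<close> is almost periodic, \<open>w - t * avg I v w\<close> is
  again the remainder of \<open>v\<close> after subtracting an almost periodic functional. In the
  expansion of its squared norm the cross term is the inner product of \<open>w\<close> with
  \<open>avg I v w\<close>, which is the mean of the squares of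
  \<open>w (orbit v h)\<close>.\<close>

lemma ap_dist_variation:
  assumes I: "inv_mean G I" and v: "\<And>a. a \<in> carrier G \<Longrightarrow> \<bar>v a\<bar> \<le> 1"
    and w: "functional C w" and ap: "almost_periodic (\<lambda>y. ip v y - w y)" and t: "t > 0"
  shows "(ap_dist v)\<^sup>2 \<le> C\<^sup>2 - 2 * t * I (\<lambda>h. (w (orbit v h))\<^sup>2) + t\<^sup>2 * C\<^sup>2"
proof -
  interpret I: inv_mean G I by (rule I)
  note [simp] = orbit_bounded[OF I v]
  define i0 where "i0 = I (\<lambda>h. (w (orbit v h))\<^sup>2)"
  \<comment> \<open>The vectors \<open>W\<close> and \<open>Z\<close> below replace \<open>w\<close>
    and \<open>avg I v w\<close>. In the cross term the first replacement costs
    \<open>C * \<epsilon>\<close> and the second \<open>\<epsilon> * (C + \<epsilon>)\<close>,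
    together \<open>\<epsilon> * (2 * C + \<epsilon>)\<close>.\<close>
  define F where "F \<epsilon> = sqrt ((C + \<epsilon>)\<^sup>2 - 2 * t * (i0 - \<epsilon> * (2 * C + \<epsilon>)) + t\<^sup>2 * (C + \<epsilon>)\<^sup>2) + (1 + t) * \<epsilon>"
    for \<epsilon>
  have vB: "v \<in> B" using v by (rule bounded_funsI)
  have C: "C \<ge> 0" using functional_nonneg[OF w] .
  have "ap_dist v \<le> F \<epsilon>" if \<epsilon>: "\<epsilon> > 0" for \<epsilon>
  proof -
    let ?T = "avg I v w"
    obtain W where W: "W \<in> B" "functional \<epsilon> (\<lambda>y. ip W y - w y)" "nrm W \<le> C + \<epsilon>"
      using functional_approx[OF w \<epsilon>] by metis
    have T: "functional C ?T" "almost_periodic ?T"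
      using functional_avg[OF I v w] almost_periodic_avg[OF I v w] by auto
    obtain Z where Z: "Z \<in> B" "functional \<epsilon> (\<lambda>y. ip Z y - ?T y)" "nrm Z \<le> C + \<epsilon>"
      using functional_approx[OF T(1) \<epsilon>] by metis
    define U where "U = (\<lambda>a. W a + (- t) * Z a)"
    have UB: "U \<in> B" using W Z unfolding U_def by (intro bounded_funs_add bounded_funs_scale)
    have "ap_dist v \<le> nrm U + (\<epsilon> + \<bar>- t\<bar> * \<epsilon>)"
    proof (rule ap_dist_le_nrm[OF _ UB])
      show "almost_periodic (\<lambda>y. ip v y - (w y - t * ?T y))"
        using almost_periodic_comb[OF ap T(2), of t] by (simp add: algebra_simps)
      have "functional (\<epsilon> + \<bar>- t\<bar> * \<epsilon>) (\<lambda>y. (ip W y - w y) + (- t) * (ip Z y - ?T y))"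
        by (intro functional_comb W Z)
      then show "functional (\<epsilon> + \<bar>- t\<bar> * \<epsilon>) (\<lambda>y. ip U y - (w y - t * ?T y))"
      proof (rule functional_eq)
        fix y assume "y \<in> B"
        then show "ip U y - (w y - t * ?T y) = (ip W y - w y) + (- t) * (ip Z y - ?T y)"
          using ip_lin[OF _ W(1) Z(1), of y "- t"]
          by (simp add: U_def ip_commute[of _ y] algebra_simps)
      qed
    qed
    moreover have "nrm U \<le> sqrt ((C + \<epsilon>)\<^sup>2 - 2 * t * (i0 - \<epsilon> * (2 * C + \<epsilon>)) + t\<^sup>2 * (C + \<epsilon>)\<^sup>2)"
    proof -
      have "\<bar>?T W - i0\<bar> \<le> C * \<epsilon>"
        unfolding avg_def i0_def
      proof (rule I.J_diff_abs_le)
        show "(\<lambda>h. w (orbit v h) * ip (orbit v h) W) \<in> B"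
          by (rule avg_integrand_bounded[OF I v w W(1)])
        show "(\<lambda>h. (w (orbit v h))\<^sup>2) \<in> B"
          unfolding power2_eq_square by (intro bounded_funs_mult functional_orbit_bounded[OF I v w])
        fix h assume h: "h \<in> carrier G"
        have "\<bar>w (orbit v h)\<bar> * \<bar>ip W (orbit v h) - w (orbit v h)\<bar> \<le> C * \<epsilon>"
          using functional_orbit[OF I v w h] functional_orbit[OF I v W(2) h] C by (intro mult_mono) auto
        then show "\<bar>w (orbit v h) * ip (orbit v h) W - (w (orbit v h))\<^sup>2\<bar> \<le> C * \<epsilon>"
          by (simp add: power2_eq_square ip_commute[of _ W] flip: abs_mult right_diff_distrib)
      qed
      moreover have "\<bar>ip Z W - ?T W\<bar> \<le> \<epsilon> * (C + \<epsilon>)"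
        using functional_bound[OF Z(2) W(1)] mult_left_mono[OF W(3), of \<epsilon>] \<epsilon> by linarith
      ultimately have "i0 - \<epsilon> * (2 * C + \<epsilon>) \<le> ip W Z"
        by (simp add: ip_commute[of W] algebra_simps)
      then have "t * (i0 - \<epsilon> * (2 * C + \<epsilon>)) \<le> t * ip W Z" using t by (intro mult_left_mono) auto
      moreover have "ip W W \<le> (C + \<epsilon>)\<^sup>2" "ip Z Z \<le> (C + \<epsilon>)\<^sup>2"
        using W Z by (auto simp flip: nrm_sq intro!: power_mono)
      moreover from this have "t\<^sup>2 * ip Z Z \<le> t\<^sup>2 * (C + \<epsilon>)\<^sup>2" by (intro mult_left_mono) auto
      moreover have "ip U U = ip W W - 2 * (t * ip W Z) + t\<^sup>2 * ip Z Z"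
        unfolding U_def using ip_lin_lin[OF W(1) Z(1), of "- t"] by simp
      ultimately have "ip U U \<le> (C + \<epsilon>)\<^sup>2 - 2 * (t * (i0 - \<epsilon> * (2 * C + \<epsilon>))) + t\<^sup>2 * (C + \<epsilon>)\<^sup>2"
        by linarith
      then show ?thesis unfolding nrm_def by (intro real_sqrt_le_mono) (simp add: mult.assoc)
    qed
    ultimately show ?thesis using t unfolding F_def by (simp add: algebra_simps)
  qed
  then have "ap_dist v \<le> F 0"
    by (rule le_at_zero_of_isCont) (auto simp: F_def intro!: continuous_intros)
  then have "sqrt ((ap_dist v)\<^sup>2) \<le> sqrt (C\<^sup>2 - 2 * t * i0 + t\<^sup>2 * C\<^sup>2)"
    using ap_dist_nonneg[OF vB] by (simp add: F_def)
  then show ?thesis unfolding i0_def by (simp only: real_sqrt_le_iff)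
qed

text \<open>The mean of \<open>x\<close> and \<open>x'\<close> is almost periodic, so the midpoint
  of the two remainders has norm at least \<open>ap_dist v\<close>. The parallelogram law then
  bounds their difference.\<close>

lemma ap_dist_parallelogram:
  assumes vB: "v \<in> B" and ap: "almost_periodic x" "almost_periodic x'"
    and x: "functional C (\<lambda>y. ip v y - x y)" "functional C (\<lambda>y. ip v y - x' y)" and y: "y \<in> B"
  shows "\<bar>x y - x' y\<bar> \<le> sqrt (4 * C\<^sup>2 - 4 * (ap_dist v)\<^sup>2) * nrm y"
proof -
  define \<delta> where "\<delta> = ap_dist v"
  define F where "F \<epsilon> = (2 * \<epsilon> + sqrt (4 * (C + \<epsilon>)\<^sup>2 - 4 * \<delta>\<^sup>2 + 8 * \<epsilon> * \<delta>)) * nrm y" for \<epsilon>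
  have \<delta>: "\<delta> \<ge> 0" using ap_dist_nonneg[OF vB] by (simp add: \<delta>_def)
  have "\<bar>x y - x' y\<bar> \<le> F \<epsilon>" if \<epsilon>: "\<epsilon> > 0" for \<epsilon>
  proof -
    obtain W where W: "W \<in> B" "functional \<epsilon> (\<lambda>y. ip W y - (ip v y - x y))" "nrm W \<le> C + \<epsilon>"
      using functional_approx[OF x(1) \<epsilon>] by metis
    obtain W' where W': "W' \<in> B" "functional \<epsilon> (\<lambda>y. ip W' y - (ip v y - x' y))" "nrm W' \<le> C + \<epsilon>"
      using functional_approx[OF x(2) \<epsilon>] by metis
    \<comment> \<open>\<open>U\<close> is the difference and \<open>V\<close> the midpoint of the
      vectors that approximate the two remainders.\<close>
    define U where "U = (\<lambda>a. W a + (- 1) * W' a)"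
    define V where "V = (\<lambda>a. (1 / 2) * (W a + 1 * W' a))"
    have UB: "U \<in> B" using W W' unfolding U_def by (intro bounded_funs_add bounded_funs_scale)
    have VB: "V \<in> B" using W W' unfolding V_def by (intro bounded_funs_add bounded_funs_scale)
    have ipV: "ip V z = (ip W z + ip W' z) / 2" if "z \<in> B" for z
    proof -
      have "ip z V = ip z (\<lambda>a. 0 + (1 / 2) * (W a + 1 * W' a))" by (simp add: V_def)
      also have "\<dots> = ip z (\<lambda>_. 0) + (1 / 2) * ip z (\<lambda>a. W a + 1 * W' a)"
        by (rule ip_lin) (use that W W' in auto)
      also have "ip z (\<lambda>a. W a + 1 * W' a) = ip z W + 1 * ip z W'"
        by (rule ip_lin[OF that W(1) W'(1)])
      also have "ip z (\<lambda>_. 0) = 0" by (simp add: ip_def J_const)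
      finally show ?thesis by (simp add: ip_commute[of _ z])
    qed
    have "\<delta> \<le> nrm V + \<epsilon>"
      unfolding \<delta>_def
    proof (rule ap_dist_le_nrm[OF _ VB])
      have "almost_periodic (\<lambda>y. (0 + (1 / 2) * x y) + (1 / 2) * x' y)"
        by (intro almost_periodic_comb almost_periodic_zero ap)
      then show "almost_periodic (\<lambda>y. ip v y - (ip v y - (x y + x' y) / 2))"
        by (simp add: add_divide_distrib)
      \<comment> \<open>Scaling by \<open>1 / 2\<close> is obtained from
        \<open>functional_comb\<close> by adding to the zero functional
        \<open>0 * J y\<close>.\<close>
      have "functional (0 * 0 + \<bar>1 / 2\<bar> * (\<epsilon> + \<bar>1\<bar> * \<epsilon>))
          (\<lambda>y. 0 * J y + (1 / 2) * ((ip W y - (ip v y - x y)) + 1 * (ip W' y - (ip v y - x' y))))"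
        by (intro functional_comb[of _ "\<lambda>y. 0 * J y"] functional_comb W W') (simp add: functional_def)
      then have "functional \<epsilon> (\<lambda>y. 0 * J y + (1 / 2) *
          ((ip W y - (ip v y - x y)) + 1 * (ip W' y - (ip v y - x' y))))" by simp
      then show "functional \<epsilon> (\<lambda>y. ip V y - (ip v y - (x y + x' y) / 2))"
        by (rule functional_eq) (simp add: ipV field_simps)
    qed
    \<comment> \<open>Squaring \<open>\<delta> - \<epsilon> \<le> nrm V\<close> requires
      \<open>\<epsilon> \<le> \<delta>\<close>; otherwise the left hand side is at most
      zero.\<close>
    have V_ge: "\<delta>\<^sup>2 - 2 * \<epsilon> * \<delta> \<le> ip V V"
    proof (cases "\<epsilon> \<le> \<delta>")
      case True
      have "(\<delta> - \<epsilon>)\<^sup>2 \<le> (nrm V)\<^sup>2"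
        using \<open>\<delta> \<le> nrm V + \<epsilon>\<close> True by (intro power_mono) auto
      moreover have "(\<delta> - \<epsilon>)\<^sup>2 = \<delta>\<^sup>2 - 2 * \<epsilon> * \<delta> + \<epsilon>\<^sup>2" by (simp add: power2_diff)
      ultimately show ?thesis using nrm_sq[OF VB] zero_le_power2[of \<epsilon>] by linarith
    next
      case False
      then have "\<delta> * \<delta> \<le> \<epsilon> * \<delta>" using \<delta> by (intro mult_right_mono) auto
      moreover have "0 \<le> \<epsilon> * \<delta>" using \<delta> \<epsilon> by simp
      ultimately show ?thesis using ip_ge_0[OF VB] by (simp add: power2_eq_square)
    qed
    have "ip W W \<le> (C + \<epsilon>)\<^sup>2" "ip W' W' \<le> (C + \<epsilon>)\<^sup>2"
      using W W' by (auto simp flip: nrm_sq intro!: power_mono)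
    moreover have "ip U U = ip W W - 2 * ip W W' + ip W' W'"
      unfolding U_def using ip_lin_lin[OF W(1) W'(1), of "- 1"] by simp
    moreover have "ip V V = (ip W W + 2 * ip W W' + ip W' W') / 4"
    proof -
      have "ip V V = (ip V W + ip V W') / 2"
        using ipV[OF VB] by (simp only: ip_commute[of W V] ip_commute[of W' V])
      also have "ip V W = (ip W W + ip W W') / 2"
        using ipV[OF W(1)] by (simp only: ip_commute[of W' W])
      also have "ip V W' = (ip W W' + ip W' W') / 2" by (rule ipV[OF W'(1)])
      finally show ?thesis by (simp add: field_simps)
    qed
    ultimately have "ip U U \<le> 4 * (C + \<epsilon>)\<^sup>2 - 4 * \<delta>\<^sup>2 + 8 * \<epsilon> * \<delta>"
      using V_ge by simp
    then have nU: "nrm U \<le> sqrt (4 * (C + \<epsilon>)\<^sup>2 - 4 * \<delta>\<^sup>2 + 8 * \<epsilon> * \<delta>)"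
      unfolding nrm_def by (rule real_sqrt_le_mono)
    have "\<bar>ip U y\<bar> \<le> nrm U * nrm y" using UB y by (rule Cauchy_Schwarz)
    also have "\<dots> \<le> sqrt (4 * (C + \<epsilon>)\<^sup>2 - 4 * \<delta>\<^sup>2 + 8 * \<epsilon> * \<delta>) * nrm y"
      using nU y by (intro mult_right_mono) auto
    finally have "\<bar>ip U y\<bar> \<le> sqrt (4 * (C + \<epsilon>)\<^sup>2 - 4 * \<delta>\<^sup>2 + 8 * \<epsilon> * \<delta>) * nrm y" .
    moreover have "ip U y = ip W y - ip W' y"
      using ip_lin[OF y W(1) W'(1), of "- 1"] by (simp add: U_def ip_commute[of _ y])
    ultimately show ?thesis
      using functional_bound[OF W(2) y] functional_bound[OF W'(2) y]
      unfolding F_def by (simp add: distrib_right)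
  qed
  then have "\<bar>x y - x' y\<bar> \<le> F 0"
    by (rule le_at_zero_of_isCont) (auto simp: F_def intro!: continuous_intros)
  then show ?thesis by (simp add: F_def \<delta>_def)
qed

lemma functional_le_limit:
  fixes F :: "real \<Rightarrow> real"
  assumes "\<And>\<epsilon>. 0 < \<epsilon> \<Longrightarrow> functional (F \<epsilon>) w" "isCont F 0"
  shows "functional (F 0) w"
proof -
  have "\<bar>w y\<bar> \<le> F 0 * nrm y" if "y \<in> B" for y
  proof (rule le_at_zero_of_isCont[where F = "\<lambda>\<epsilon>. F \<epsilon> * nrm y"])
    show "isCont (\<lambda>\<epsilon>. F \<epsilon> * nrm y) 0" using assms(2) by (intro continuous_intros)
  qed (use assms(1) functional_bound that in blast)
  moreover have "functional (F 1) w" by (rule assms(1)) simp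
  ultimately show ?thesis unfolding functional_def by blast
qed

text \<open>Near minimisers are Cauchy in the dual norm by the parallelogram estimate. Their
  pointwise limit is also a limit in the dual norm, so it is almost periodic and attains the
  distance.\<close>

lemma ap_dist_attained:
  assumes vB: "v \<in> B"
  obtains x where "almost_periodic x" "functional (ap_dist v) (\<lambda>y. ip v y - x y)"
proof -
  define \<delta> where "\<delta> = ap_dist v"
  \<comment> \<open>The bound of \<open>ap_dist_parallelogram\<close> for two near minimisers whose
    excess over \<open>\<delta>\<close> is at most \<open>e\<close>.\<close>
  define r where "r e = sqrt (4 * (\<delta> + e)\<^sup>2 - 4 * \<delta>\<^sup>2)" for e
  have \<delta>: "\<delta> \<ge> 0" using ap_dist_nonneg[OF vB] by (simp add: \<delta>_def)
  have r0: "r 0 = 0" by (simp add: r_def)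
  have r_cont: "isCont r 0" unfolding r_def by (intro continuous_intros)
  have "\<exists>x. almost_periodic x \<and> functional (\<delta> + e) (\<lambda>y. ip v y - x y)" if "e > 0" for e
    using ap_dist_near[OF vB that] unfolding \<delta>_def by metis
  then obtain X where X: "\<And>e. e > 0 \<Longrightarrow> almost_periodic (X e)"
    "\<And>e. e > 0 \<Longrightarrow> functional (\<delta> + e) (\<lambda>y. ip v y - X e y)"
    by metis
  have close: "\<bar>X d y - X e y\<bar> \<le> r e * nrm y" if "0 < d" "d \<le> e" "y \<in> B" for d e y
    using that functional_mono[OF X(2)[of d], of "\<delta> + e"] X(1)[of d] X(1)[of e] X(2)[of e]
    unfolding r_def \<delta>_def by (intro ap_dist_parallelogram[OF vB]) auto
  define x where "x y = lim (\<lambda>n. X (inverse (real (Suc n))) y)" for y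
  have conv: "(\<lambda>n. X (inverse (real (Suc n))) y) \<longlonglongrightarrow> x y" if y: "y \<in> B" for y
  proof -
    have lim0: "(\<lambda>n. r (inverse (real (Suc n))) * nrm y) \<longlonglongrightarrow> 0"
      using tendsto_mult_left_zero[OF isCont_tendsto_compose[OF r_cont LIMSEQ_inverse_real_of_nat, unfolded r0]] .
    have "Cauchy (\<lambda>n. X (inverse (real (Suc n))) y)"
    proof (rule CauchyI)
      fix e :: real assume "e > 0"
      then have "e / 2 > 0" by simp
      with lim0 obtain N where N: "\<And>n. n \<ge> N \<Longrightarrow> norm (r (inverse (real (Suc n))) * nrm y - 0) < e / 2"
        unfolding LIMSEQ_iff by blast
      have "\<bar>X (inverse (real (Suc n))) y - X (inverse (real (Suc N))) y\<bar> < e / 2" if "n \<ge> N" for n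
        using close[of "inverse (real (Suc n))" "inverse (real (Suc N))", OF _ _ y] N[of N] that
        by (simp add: le_imp_inverse_le)
      then show "\<exists>M. \<forall>m\<ge>M. \<forall>n\<ge>M. norm (X (inverse (real (Suc m))) y - X (inverse (real (Suc n))) y) < e"
        by (intro exI[of _ N]) (smt (verit) real_norm_def field_sum_of_halves)
    qed
    then show ?thesis
      unfolding x_def by (simp add: Cauchy_convergent_iff convergent_LIMSEQ_iff)
  qed
  have close': "\<bar>x y - X e y\<bar> \<le> r e * nrm y" if e: "e > 0" and y: "y \<in> B" for e y
  proof (rule tendsto_upperbound)
    show "(\<lambda>n. \<bar>X (inverse (real (Suc n))) y - X e y\<bar>) \<longlonglongrightarrow> \<bar>x y - X e y\<bar>"
      by (intro tendsto_intros conv y)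
    obtain N where N: "inverse (real (Suc N)) < e" using reals_Archimedean[OF e] by blast
    show "\<forall>\<^sub>F n in sequentially. \<bar>X (inverse (real (Suc n))) y - X e y\<bar> \<le> r e * nrm y"
    proof (rule eventually_sequentiallyI[of N])
      fix n assume "n \<ge> N"
      then have "inverse (real (Suc n)) \<le> inverse (real (Suc N))" by (simp add: le_imp_inverse_le)
      then have "inverse (real (Suc n)) \<le> e" using N by linarith
      then show "\<bar>X (inverse (real (Suc n))) y - X e y\<bar> \<le> r e * nrm y"
        using y by (intro close) simp_all
    qed
  qed simp
  have X_fun: "X e (\<lambda>a. y a + t * z a) = X e y + t * X e z" if "e > 0" "y \<in> B" "z \<in> B" for e y z t
    using X(1)[OF that(1)] functional_lin that(2,3) unfolding almost_periodic_def by blast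
  have x_lin: "x (\<lambda>a. y a + t * z a) = x y + t * x z" if "y \<in> B" "z \<in> B" for y z t
  proof (rule LIMSEQ_unique)
    show "(\<lambda>n. X (inverse (real (Suc n))) (\<lambda>a. y a + t * z a)) \<longlonglongrightarrow> x (\<lambda>a. y a + t * z a)"
      by (rule conv) (use that in auto)
    have "(\<lambda>n. X (inverse (real (Suc n))) y + t * X (inverse (real (Suc n))) z) \<longlonglongrightarrow> x y + t * x z"
      by (intro tendsto_intros conv that)
    then show "(\<lambda>n. X (inverse (real (Suc n))) (\<lambda>a. y a + t * z a)) \<longlonglongrightarrow> x y + t * x z"
      using that by (simp add: X_fun)
  qed
  have diff: "functional (r e) (\<lambda>y. x y - X e y)" if "e > 0" for e
    unfolding functional_def using close' that by (simp add: x_lin X_fun algebra_simps)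
  have "functional (\<delta> + 0 + r 0) (\<lambda>y. ip v y - x y)"
  proof (rule functional_le_limit)
    fix e :: real assume e: "e > 0"
    show "functional (\<delta> + e + r e) (\<lambda>y. ip v y - x y)"
      using functional_minus[OF X(2)[OF e] diff[OF e]] by simp
  qed (intro continuous_intros r_cont)
  then have 1: "functional \<delta> (\<lambda>y. ip v y - x y)" by (simp add: r0)
  have fx: "functional (nrm v + \<delta>) x"
    using functional_minus[OF functional_ip[OF vB] 1] by simp
  have "almost_periodic x"
  proof (rule almost_periodic_limit[OF fx])
    fix \<epsilon> :: real assume "\<epsilon> > 0"
    have "((\<lambda>n. r (inverse (real (Suc n)))) \<longlonglongrightarrow> 0)"
      using isCont_tendsto_compose[OF r_cont LIMSEQ_inverse_real_of_nat] by (simp add: r0)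
    then have "\<forall>\<^sub>F n in sequentially. r (inverse (real (Suc n))) < \<epsilon>"
      using \<open>\<epsilon> > 0\<close> by (rule order_tendstoD)
    then obtain n where "r (inverse (real (Suc n))) < \<epsilon>"
      using eventually_happens'[OF sequentially_bot] by blast
    then have "functional \<epsilon> (\<lambda>y. x y - X (inverse (real (Suc n))) y)"
      using functional_mono[OF diff] by simp
    then show "\<exists>z. almost_periodic z \<and> functional \<epsilon> (\<lambda>y. x y - z y)"
      using X(1)[of "inverse (real (Suc n))"] by auto
  qed
  then show thesis using that 1 unfolding \<delta>_def by blast
qed

text \<open>
  \<open>x\<close> is the orthogonal projection of \<open>v\<close> onto the almost periodic functionals; the remainder
  \<open>v - x\<close> is weakly mixing with respect to every invariant mean.
\<close>

lemma almost_periodic_splitting: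
  assumes v: "\<And>a. a \<in> carrier G \<Longrightarrow> \<bar>v a\<bar> \<le> 1"
  obtains x where "almost_periodic x" "functional (ap_dist v) (\<lambda>y. ip v y - x y)"
    "\<And>I. inv_mean G I \<Longrightarrow> I (\<lambda>h. (ip v (orbit v h) - x (orbit v h))\<^sup>2) = 0"
proof -
  define \<delta> where "\<delta> = ap_dist v"
  have vB: "v \<in> B" using v by (rule bounded_funsI)
  obtain x where x: "almost_periodic x" "functional \<delta> (\<lambda>y. ip v y - x y)"
    using ap_dist_attained[OF vB] unfolding \<delta>_def by metis
  have "I (\<lambda>h. (ip v (orbit v h) - x (orbit v h))\<^sup>2) = 0" if I: "inv_mean G I" for I
  proof -
    interpret I: inv_mean G I by (rule I)
    let ?i = "I (\<lambda>h. (ip v (orbit v h) - x (orbit v h))\<^sup>2)"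
    have bd: "(\<lambda>h. (ip v (orbit v h) - x (orbit v h))\<^sup>2) \<in> B"
      using functional_orbit_bounded[OF I v x(2)] unfolding power2_eq_square by auto
    \<comment> \<open>The remainder attains the distance, so the squares of \<open>\<delta>\<close>
      on both sides of the variation inequality cancel. After division by \<open>t\<close> the bound
      vanishes as \<open>t\<close> tends to 0.\<close>
    have "?i \<le> t * \<delta>\<^sup>2 / 2" if "t > 0" for t
    proof -
      have "\<delta>\<^sup>2 \<le> \<delta>\<^sup>2 - 2 * t * ?i + t\<^sup>2 * \<delta>\<^sup>2"
        using ap_dist_variation[OF I v x(2) _ that] x(1) unfolding \<delta>_def by simp
      then have "t * ?i \<le> t * (t * \<delta>\<^sup>2 / 2)" by (simp add: power2_eq_square algebra_simps)
      then show ?thesis using that by (simp only: mult_le_cancel_left_pos)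
    qed
    then have "?i \<le> 0 * \<delta>\<^sup>2 / 2"
      by (rule le_at_zero_of_isCont) (auto intro!: continuous_intros)
    moreover have "0 \<le> ?i"
      using I.J_mono[of "\<lambda>_. 0", OF _ bd] by (simp add: I.J_const)
    ultimately show ?thesis by simp
  qed
  then show thesis using that x unfolding \<delta>_def by blast
qed

text \<open>Comparing \<open>v\<close> with the almost periodic functional \<open>J v * J\<close> gives \<open>(ap_dist v)\<^sup>2 \<le> J v - (J v)\<^sup>2\<close>.\<close>

lemma projection_pos:
  assumes v: "\<And>a. a \<in> carrier G \<Longrightarrow> v a \<in> {0, 1}" and "J v > 0"
    and x: "functional (ap_dist v) (\<lambda>y. ip v y - x y)"
  shows "x v > 0"
proof -
  define \<alpha> where "\<alpha> = J v"
  have vB: "v \<in> B" using v by (intro bounded_funsI[of _ _ 1]) force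
  have vv: "ip v v = \<alpha>"
    unfolding ip_def \<alpha>_def by (rule J_cong) (use v vB in force)+
  have v1: "ip v (\<lambda>_. 1) = \<alpha>" by (simp add: ip_def \<alpha>_def)
  define u where "u = (\<lambda>a. v a + (- \<alpha>) * 1)"
  have uB: "u \<in> B" unfolding u_def using vB by (intro bounded_funs_add bounded_funs_scale) auto
  have "ip u u = ip v v + 2 * (- \<alpha>) * ip v (\<lambda>_. 1) + (- \<alpha>)\<^sup>2 * ip (\<lambda>_. 1) (\<lambda>_. 1)"
    unfolding u_def using vB by (intro ip_lin_lin) auto
  moreover have "ip (\<lambda>_. 1) (\<lambda>_. 1) = 1" by (simp add: ip_def J_one)
  ultimately have uu: "ip u u = \<alpha> - \<alpha>\<^sup>2"
    by (simp add: vv v1 power2_eq_square)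
  have "ap_dist v \<le> nrm u"
  proof (rule ap_dist_le)
    show "almost_periodic (\<lambda>y. 0 + \<alpha> * J y)"
      by (intro almost_periodic_comb almost_periodic_zero almost_periodic_J)
    have "ip v y - (0 + \<alpha> * J y) = ip u y" if "y \<in> B" for y
      using ip_lin[OF that vB, of "\<lambda>_. 1" "- \<alpha>"]
      by (simp add: u_def ip_commute[of _ y]) (simp add: ip_def)
    then show "functional (nrm u) (\<lambda>y. ip v y - (0 + \<alpha> * J y))"
      by (rule functional_eq[OF functional_ip[OF uB]])
  qed
  also have "nrm u < sqrt \<alpha>"
    using assms(2) by (simp add: nrm_def uu \<alpha>_def)
  finally have "ap_dist v * sqrt \<alpha> < sqrt \<alpha> * sqrt \<alpha>"
    by (rule mult_strict_right_mono) (use assms(2) in \<open>simp add: \<alpha>_def\<close>)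
  then have "ap_dist v * sqrt \<alpha> < \<alpha>" using assms(2) by (simp add: \<alpha>_def)
  \<comment> \<open>The remainder is evaluated at \<open>v\<close> itself: \<open>ip v v\<close> is
    \<open>\<alpha>\<close> and \<open>nrm v\<close> is \<open>sqrt \<alpha>\<close>.\<close>
  moreover have "\<bar>\<alpha> - x v\<bar> \<le> ap_dist v * sqrt \<alpha>"
    using functional_bound[OF x vB] by (simp add: vv nrm_def)
  ultimately show ?thesis by linarith
qed

end

section \<open>Bohr sets from almost periodic functions\<close>

text \<open>In the applications \<open>r s\<close> measures how far \<open>s\<close> is from a point
  of the completion, and \<open>z\<close> is the value there of the extension of
  \<open>\<psi>\<close>: the limit along parameters with \<open>r\<close> tending to 0.\<close>

lemma uniform_extension_point:
  fixes \<psi> :: "'s \<Rightarrow> 'k::complete_space" and r :: "'s \<Rightarrow> real"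
  assumes small: "\<And>e. e > 0 \<Longrightarrow> \<exists>s\<in>S. r s < e"
    and \<psi>: "\<And>s t. s \<in> S \<Longrightarrow> t \<in> S \<Longrightarrow> dist (\<psi> s) (\<psi> t) \<le> r s + r t"
  shows "\<exists>z\<in>closure (\<psi> ` S). \<forall>s\<in>S. dist z (\<psi> s) \<le> r s"
proof -
  have "\<exists>s\<in>S. r s < inverse (real (Suc n))" for n by (rule small) simp
  then obtain s where s: "\<And>n. s n \<in> S" "\<And>n. r (s n) < inverse (real (Suc n))" by metis
  have "Cauchy (\<lambda>n. \<psi> (s n))"
  proof (rule metric_CauchyI)
    fix e :: real assume "e > 0"
    then obtain N where N: "inverse (real (Suc N)) < e / 2" using reals_Archimedean[of "e / 2"] by auto
    have rs: "r (s n) < e / 2" if "n \<ge> N" for n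
    proof -
      have "inverse (real (Suc n)) \<le> inverse (real (Suc N))" using that by (simp add: le_imp_inverse_le)
      then show ?thesis using s(2)[of n] N by linarith
    qed
    have "dist (\<psi> (s m)) (\<psi> (s n)) < e" if "m \<ge> N" "n \<ge> N" for m n
      using \<psi>[OF s(1)[of m] s(1)[of n]] rs[OF that(1)] rs[OF that(2)] by linarith
    then show "\<exists>M. \<forall>m\<ge>M. \<forall>n\<ge>M. dist (\<psi> (s m)) (\<psi> (s n)) < e" by blast
  qed
  then obtain z where z: "(\<lambda>n. \<psi> (s n)) \<longlonglongrightarrow> z"
    using Cauchy_convergent_iff convergent_def by blast
  have "dist z (\<psi> t) \<le> r t" if t: "t \<in> S" for t
  proof (rule LIMSEQ_le)
    show "(\<lambda>n. dist (\<psi> (s n)) (\<psi> t)) \<longlonglongrightarrow> dist z (\<psi> t)" by (intro tendsto_intros z)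
    have "(\<lambda>n. inverse (real (Suc n)) + r t) \<longlonglongrightarrow> 0 + r t"
      by (intro tendsto_intros LIMSEQ_inverse_real_of_nat)
    then show "(\<lambda>n. inverse (real (Suc n)) + r t) \<longlonglongrightarrow> r t" by simp
    have "dist (\<psi> (s n)) (\<psi> t) \<le> inverse (real (Suc n)) + r t" for n
      using \<psi>[OF s(1) t, of n] s(2)[of n] by linarith
    then show "\<exists>N. \<forall>n\<ge>N. dist (\<psi> (s n)) (\<psi> t) \<le> inverse (real (Suc n)) + r t" by blast
  qed
  moreover have "z \<in> closure (\<psi> ` S)"
    unfolding closure_sequential using z s(1) by (intro exI[of _ "\<lambda>n. \<psi> (s n)"]) auto
  ultimately show ?thesis by blast
qed

lemma dist_le_all_imp_eq:
  fixes x y :: "'k::metric_space"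
  assumes "\<And>e. e > 0 \<Longrightarrow> dist x y \<le> k * e"
  shows "x = y"
proof -
  have "dist x y \<le> e" if "e > 0" for e
  proof -
    define d where "d = e / (\<bar>k\<bar> + 1)"
    have "d > 0" using that by (simp add: d_def add_nonneg_pos)
    have "(\<bar>k\<bar> + 1) * d = e" by (simp add: d_def)
    then have "\<bar>k\<bar> * d \<le> e" using \<open>d > 0\<close> by (simp add: distrib_right)
    moreover have "k * d \<le> \<bar>k\<bar> * d" using \<open>d > 0\<close> by (intro mult_right_mono) auto
    ultimately show ?thesis using assms[OF \<open>d > 0\<close>] by linarith
  qed
  then show ?thesis using field_le_epsilon[of "dist x y" 0] by simp
qed

text \<open>
  The compact group is the completion of \<open>G\<close> for the pseudometric \<open>dist (\<iota> g) (\<iota> h)\<close>.  Its operations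
  are pinned down by their distances to the points of \<open>\<iota> ` carrier G\<close>.
\<close>

lemma (in group) compact_completion:
  fixes \<iota> :: "'a \<Rightarrow> 'k::complete_space"
  assumes mult: "\<And>g h g' h'. \<lbrakk>g \<in> carrier G; h \<in> carrier G; g' \<in> carrier G; h' \<in> carrier G\<rbrakk> \<Longrightarrow>
      dist (\<iota> (g \<otimes> h)) (\<iota> (g' \<otimes> h')) \<le> dist (\<iota> g) (\<iota> g') + dist (\<iota> h) (\<iota> h')"
    and inv: "\<And>g h. \<lbrakk>g \<in> carrier G; h \<in> carrier G\<rbrakk> \<Longrightarrow> dist (\<iota> (inv g)) (\<iota> (inv h)) \<le> dist (\<iota> g) (\<iota> h)"
    and tb: "\<And>\<epsilon>. \<epsilon> > 0 \<Longrightarrow> \<exists>c :: 'a \<Rightarrow> nat. finite (c ` carrier G) \<and>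
      (\<forall>g\<in>carrier G. \<forall>h\<in>carrier G. c g = c h \<longrightarrow> dist (\<iota> g) (\<iota> h) \<le> \<epsilon>)"
  obtains K :: "'k monoid" where "dense_compact_hom G K (top_of_set (carrier K)) \<iota>"
    "\<one>\<^bsub>K\<^esub> = \<iota> \<one>"
proof -
  define C where "C = closure (\<iota> ` carrier G)"
  have \<iota>C [simp]: "\<iota> g \<in> C" if "g \<in> carrier G" for g
    unfolding C_def using that by (intro subsetD[OF closure_subset] imageI)
  have approx: "\<exists>g\<in>carrier G. dist x (\<iota> g) < e" if "x \<in> C" "e > 0" for x e
    using that unfolding C_def closure_approachable by (auto simp: dist_commute)
  have "\<exists>z\<in>C. \<forall>g\<in>carrier G. \<forall>h\<in>carrier G. dist z (\<iota> (g \<otimes> h)) \<le> dist x (\<iota> g) + dist y (\<iota> h)"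
    if x: "x \<in> C" and y: "y \<in> C" for x y
  proof -
    define \<psi> where "\<psi> p = \<iota> (fst p \<otimes> snd p)" for p
    define r where "r p = dist x (\<iota> (fst p)) + dist y (\<iota> (snd p))" for p
    have "\<exists>z\<in>closure (\<psi> ` (carrier G \<times> carrier G)). \<forall>p\<in>carrier G \<times> carrier G. dist z (\<psi> p) \<le> r p"
    proof (rule uniform_extension_point)
      fix e :: real assume "e > 0"
      then obtain g h where gh: "g \<in> carrier G" "dist x (\<iota> g) < e / 2" "h \<in> carrier G" "dist y (\<iota> h) < e / 2"
        using approx[OF x, of "e / 2"] approx[OF y, of "e / 2"] by auto
      then have "r (g, h) < e" unfolding r_def by simp
      then show "\<exists>p\<in>carrier G \<times> carrier G. r p < e" using gh by blast
    next
      fix p q assume "p \<in> carrier G \<times> carrier G" "q \<in> carrier G \<times> carrier G"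
      then have "dist (\<psi> p) (\<psi> q) \<le> dist (\<iota> (fst p)) (\<iota> (fst q)) + dist (\<iota> (snd p)) (\<iota> (snd q))"
        unfolding \<psi>_def by (intro mult) auto
      also have "\<dots> \<le> r p + r q"
        using dist_triangle[of "\<iota> (fst p)" "\<iota> (fst q)" x] dist_triangle[of "\<iota> (snd p)" "\<iota> (snd q)" y]
        unfolding r_def by (simp add: dist_commute)
      finally show "dist (\<psi> p) (\<psi> q) \<le> r p + r q" .
    qed
    moreover have "closure (\<psi> ` (carrier G \<times> carrier G)) \<subseteq> C"
      unfolding C_def \<psi>_def by (rule closure_mono) auto
    ultimately show ?thesis unfolding \<psi>_def r_def by fastforce
  qed
  then obtain m where m: "\<And>x y. \<lbrakk>x \<in> C; y \<in> C\<rbrakk> \<Longrightarrow> m x y \<in> C"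
    and m_dist: "\<And>x y g h. \<lbrakk>x \<in> C; y \<in> C; g \<in> carrier G; h \<in> carrier G\<rbrakk> \<Longrightarrow>
      dist (m x y) (\<iota> (g \<otimes> h)) \<le> dist x (\<iota> g) + dist y (\<iota> h)"
    by metis
  have "\<exists>z\<in>C. \<forall>g\<in>carrier G. dist z (\<iota> (inv g)) \<le> dist x (\<iota> g)" if x: "x \<in> C" for x
  proof -
    have "\<exists>z\<in>closure ((\<lambda>g. \<iota> (inv g)) ` carrier G). \<forall>g\<in>carrier G. dist z (\<iota> (inv g)) \<le> dist x (\<iota> g)"
    proof (rule uniform_extension_point)
      fix g h assume "g \<in> carrier G" "h \<in> carrier G"
      then have "dist (\<iota> (inv g)) (\<iota> (inv h)) \<le> dist (\<iota> g) (\<iota> h)" by (rule inv)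
      then show "dist (\<iota> (inv g)) (\<iota> (inv h)) \<le> dist x (\<iota> g) + dist x (\<iota> h)"
        using dist_triangle[of "\<iota> g" "\<iota> h" x] by (simp add: dist_commute)
    qed (use approx[OF x] in blast)
    moreover have "closure ((\<lambda>g. \<iota> (inv g)) ` carrier G) \<subseteq> C"
      unfolding C_def by (rule closure_mono) auto
    ultimately show ?thesis by blast
  qed
  then obtain n where n: "\<And>x. x \<in> C \<Longrightarrow> n x \<in> C"
    and n_dist: "\<And>x g. \<lbrakk>x \<in> C; g \<in> carrier G\<rbrakk> \<Longrightarrow> dist (n x) (\<iota> (inv g)) \<le> dist x (\<iota> g)"
    by metis
  have m_\<iota>: "m (\<iota> g) (\<iota> h) = \<iota> (g \<otimes> h)" if "g \<in> carrier G" "h \<in> carrier G" for g h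
    using m_dist[of "\<iota> g" "\<iota> h" g h] that by simp
  \<comment> \<open>The group laws pass from the image of \<open>G\<close> to its closure by
    approximation; here both sides are within \<open>3 * e\<close> of
    \<open>\<iota> (g \<otimes> h \<otimes> k)\<close>.\<close>
  have m_assoc': "m (m x y) z = m x (m y z)" if xyz: "x \<in> C" "y \<in> C" "z \<in> C" for x y z
  proof (rule dist_le_all_imp_eq)
    fix e :: real assume "e > 0"
    then obtain g h k where ghk: "g \<in> carrier G" "h \<in> carrier G" "k \<in> carrier G"
      "dist x (\<iota> g) < e" "dist y (\<iota> h) < e" "dist z (\<iota> k) < e" using approx xyz by meson
    have "dist (m (m x y) z) (\<iota> (g \<otimes> h \<otimes> k)) \<le> dist (m x y) (\<iota> (g \<otimes> h)) + dist z (\<iota> k)"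
      using xyz ghk by (intro m_dist m) auto
    moreover have "dist (m x y) (\<iota> (g \<otimes> h)) \<le> dist x (\<iota> g) + dist y (\<iota> h)"
      using xyz ghk by (intro m_dist)
    moreover have "dist (m x (m y z)) (\<iota> (g \<otimes> (h \<otimes> k))) \<le> dist x (\<iota> g) + dist (m y z) (\<iota> (h \<otimes> k))"
      using xyz ghk by (intro m_dist m) auto
    moreover have "dist (m y z) (\<iota> (h \<otimes> k)) \<le> dist y (\<iota> h) + dist z (\<iota> k)"
      using xyz ghk by (intro m_dist)
    ultimately show "dist (m (m x y) z) (m x (m y z)) \<le> 6 * e"
      using ghk dist_triangle2[of "m (m x y) z" "m x (m y z)" "\<iota> (g \<otimes> h \<otimes> k)"]
      by (simp add: m_assoc)
  qed
  have m_one: "m (\<iota> \<one>) x = x" if x: "x \<in> C" for x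
  proof (rule dist_le_all_imp_eq)
    fix e :: real assume "e > 0"
    then obtain g where g: "g \<in> carrier G" "dist x (\<iota> g) < e" using approx x by meson
    then have "dist (m (\<iota> \<one>) x) (\<iota> g) \<le> dist x (\<iota> g)"
      using m_dist[of "\<iota> \<one>" x \<one> g] x by simp
    then show "dist (m (\<iota> \<one>) x) x \<le> 2 * e"
      using g dist_triangle2[of "m (\<iota> \<one>) x" x "\<iota> g"] by simp
  qed
  have m_n: "m (n x) x = \<iota> \<one>" if x: "x \<in> C" for x
  proof (rule dist_le_all_imp_eq)
    fix e :: real assume "e > 0"
    then obtain g where g: "g \<in> carrier G" "dist x (\<iota> g) < e" using approx x by meson
    have "dist (m (n x) x) (\<iota> (inv g \<otimes> g)) \<le> dist (n x) (\<iota> (inv g)) + dist x (\<iota> g)"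
      using x g n by (intro m_dist) auto
    then show "dist (m (n x) x) (\<iota> \<one>) \<le> 2 * e"
      using g n_dist[OF x g(1)] by simp
  qed
  have m_Lipschitz: "dist (m x y) (m x' y') \<le> dist x x' + dist y y'"
    if xy: "x \<in> C" "y \<in> C" "x' \<in> C" "y' \<in> C" for x y x' y'
  proof (rule field_le_epsilon)
    fix e :: real assume "e > 0"
    then have "e / 4 > 0" by simp
    then obtain g h where gh: "g \<in> carrier G" "h \<in> carrier G" "dist x (\<iota> g) < e / 4" "dist y (\<iota> h) < e / 4"
      using approx xy by meson
    show "dist (m x y) (m x' y') \<le> dist x x' + dist y y' + e"
      using gh m_dist[OF xy(1,2) gh(1,2)] m_dist[OF xy(3,4) gh(1,2)]
        dist_triangle2[of "m x y" "m x' y'" "\<iota> (g \<otimes> h)"]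
        dist_triangle[of x' "\<iota> g" x] dist_triangle[of y' "\<iota> h" y]
      by (simp add: dist_commute)
  qed
  have n_Lipschitz: "dist (n x) (n y) \<le> dist x y" if xy: "x \<in> C" "y \<in> C" for x y
  proof (rule field_le_epsilon)
    fix e :: real assume "e > 0"
    then have "e / 2 > 0" by simp
    then obtain g where g: "g \<in> carrier G" "dist x (\<iota> g) < e / 2" using approx xy by meson
    show "dist (n x) (n y) \<le> dist x y + e"
      using g n_dist[OF xy(1) g(1)] n_dist[OF xy(2) g(1)]
        dist_triangle2[of "n x" "n y" "\<iota> (inv g)"] dist_triangle[of y "\<iota> g" x]
      by (simp add: dist_commute)
  qed
  define K :: "'k monoid" where "K = \<lparr>carrier = C, monoid.mult = m, one = \<iota> \<one>\<rparr>"
  have K [simp]: "carrier K = C" "x \<otimes>\<^bsub>K\<^esub> y = m x y" "\<one>\<^bsub>K\<^esub> = \<iota> \<one>" for x y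
    by (simp_all add: K_def)
  have "group K"
  proof (rule groupI)
    show "\<exists>y\<in>carrier K. y \<otimes>\<^bsub>K\<^esub> x = \<one>\<^bsub>K\<^esub>" if "x \<in> carrier K" for x
      using that n m_n by (intro bexI[of _ "n x"]) auto
  qed (use m m_assoc' m_one in auto)
  then interpret K: group K .
  have inv_K: "inv\<^bsub>K\<^esub> x = n x" if "x \<in> C" for x
    by (rule K.inv_equality) (use that m_n n in auto)
  have "topological_group K (top_of_set C)"
  proof
    show "topspace (top_of_set C) = carrier K" by simp
    have "continuous_on (C \<times> C) (\<lambda>p. m (fst p) (snd p))"
    proof (rule continuous_onI)
      fix p e assume p: "p \<in> C \<times> C" and "(e::real) > 0"
      have "dist (m (fst q) (snd q)) (m (fst p) (snd p)) \<le> e" if "q \<in> C \<times> C" "dist q p < e / 2" for q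
        using m_Lipschitz[of "fst q" "snd q" "fst p" "snd p"] that p
          dist_fst_le[of q p] dist_snd_le[of q p] by auto
      then show "\<exists>d>0. \<forall>q\<in>C \<times> C. dist q p < d \<longrightarrow> dist (m (fst q) (snd q)) (m (fst p) (snd p)) \<le> e"
        using \<open>e > 0\<close> by (intro exI[of _ "e / 2"]) auto
    qed
    then show "continuous_map (prod_topology (top_of_set C) (top_of_set C)) (top_of_set C)
        (\<lambda>(x, y). x \<otimes>\<^bsub>K\<^esub> y)"
      using m by (auto simp: split_beta)
    have "continuous_on C n"
    proof (rule continuous_onI)
      fix x e assume "x \<in> C" "(e::real) > 0"
      then show "\<exists>d>0. \<forall>y\<in>C. dist y x < d \<longrightarrow> dist (n y) (n x) \<le> e"
        using n_Lipschitz by (intro exI[of _ e]) fastforce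
    qed
    then have "continuous_map (top_of_set C) (top_of_set C) n"
      using n by (auto simp: continuous_map_subtopology_eu)
    then show "continuous_map (top_of_set C) (top_of_set C) (\<lambda>x. inv\<^bsub>K\<^esub> x)"
      by (rule continuous_map_eq) (simp add: inv_K)
  qed
  moreover have "compact C"
    unfolding compact_eq_totally_bounded
  proof (intro conjI allI impI)
    show "complete C" by (simp add: C_def complete_eq_closed)
    fix e :: real assume "e > 0"
    then obtain c :: "'a \<Rightarrow> nat" where c: "finite (c ` carrier G)"
      "\<And>g h. \<lbrakk>g \<in> carrier G; h \<in> carrier G; c g = c h\<rbrakk> \<Longrightarrow> dist (\<iota> g) (\<iota> h) \<le> e / 2"
      using tb[of "e / 2"] by auto
    \<comment> \<open>One representative of each colour gives a finite net. Closed balls of radius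
      \<open>e / 2\<close> let the cover pass to the closure.\<close>
    obtain F where F: "F \<subseteq> carrier G" "finite F" "c ` carrier G = c ` F"
      using finite_subset_image[OF c(1) subset_refl] by blast
    have "\<iota> ` carrier G \<subseteq> (\<Union>k\<in>F. cball (\<iota> k) (e / 2))"
    proof safe
      fix g assume "g \<in> carrier G"
      moreover then obtain k where "k \<in> F" "c k = c g" using F(3) by (metis imageE imageI)
      ultimately show "\<iota> g \<in> (\<Union>k\<in>F. cball (\<iota> k) (e / 2))" using c(2)[of k g] F(1) by auto
    qed
    then have "C \<subseteq> (\<Union>k\<in>F. cball (\<iota> k) (e / 2))"
      unfolding C_def using F(2) by (intro closure_minimal closed_UN) auto
    also have "\<dots> \<subseteq> (\<Union>x\<in>\<iota> ` F. ball x e)" using \<open>e > 0\<close> by fastforce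
    finally show "\<exists>k. finite k \<and> C \<subseteq> (\<Union>x\<in>k. ball x e)" using F(2) by blast
  qed
  then have "compact_space (top_of_set C)" by (simp add: compact_space_subtopology)
  moreover have "Hausdorff_space (top_of_set C)"
    by (simp add: Hausdorff_space_subtopology)
  moreover have "\<iota> \<in> hom G K" by (auto simp: hom_def m_\<iota>)
  moreover have "top_of_set C closure_of (\<iota> ` carrier G) = topspace (top_of_set C)"
  proof -
    have "C \<inter> \<iota> ` carrier G = \<iota> ` carrier G" by auto
    then show ?thesis by (simp add: closure_of_subtopology C_def)
  qed
  ultimately have "dense_compact_hom G K (top_of_set (carrier K)) \<iota>"
    by (simp add: dense_compact_hom_def)
  then show thesis by (rule that) simp
qed

text \<open>Replacing \<open>a\<close> by a representative \<open>k\<close> of its colour costs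
  \<open>\<epsilon> / 3\<close> twice. So it suffices that the colour of \<open>g\<close> records
  \<open>c (k \<otimes> g)\<close> for the finitely many representatives \<open>k\<close>.\<close>

lemma (in group) two_sided_coloring:
  assumes left: "\<And>\<epsilon>. \<epsilon> > 0 \<Longrightarrow> \<exists>c :: 'a \<Rightarrow> nat. finite (c ` carrier G) \<and>
      (\<forall>g\<in>carrier G. \<forall>h\<in>carrier G. c g = c h \<longrightarrow> (\<forall>b\<in>carrier G. \<bar>f (g \<otimes> b) - f (h \<otimes> b)\<bar> \<le> \<epsilon>))"
    and \<epsilon>: "\<epsilon> > (0::real)"
  shows "\<exists>c :: 'a \<Rightarrow> nat. finite (c ` carrier G) \<and>
      (\<forall>g\<in>carrier G. \<forall>h\<in>carrier G. c g = c h \<longrightarrow>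
        (\<forall>a\<in>carrier G. \<forall>b\<in>carrier G. \<bar>f (a \<otimes> g \<otimes> b) - f (a \<otimes> h \<otimes> b)\<bar> \<le> \<epsilon>))"
proof -
  have "\<epsilon> / 3 > 0" using \<epsilon> by simp
  then obtain c :: "'a \<Rightarrow> nat" where c: "finite (c ` carrier G)"
    "\<And>g h b. \<lbrakk>g \<in> carrier G; h \<in> carrier G; c g = c h; b \<in> carrier G\<rbrakk> \<Longrightarrow> \<bar>f (g \<otimes> b) - f (h \<otimes> b)\<bar> \<le> \<epsilon> / 3"
    using left by metis
  obtain F where F: "F \<subseteq> carrier G" "finite F" "c ` carrier G = c ` F"
    using finite_subset_image[OF c(1) subset_refl] by blast
  define col where "col g = restrict (\<lambda>k. c (k \<otimes> g)) F" for g
  have "col ` carrier G \<subseteq> (\<Pi>\<^sub>E k\<in>F. c ` carrier G)"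
    using F(1) by (auto simp: col_def)
  then have "finite (col ` carrier G)" by (rule finite_subset) (use F(2) c(1) in \<open>auto intro: finite_PiE\<close>)
  then obtain c' :: "'a \<Rightarrow> nat" where c': "finite (c' ` carrier G)"
    "\<And>g h. g \<in> carrier G \<Longrightarrow> h \<in> carrier G \<Longrightarrow> c' g = c' h \<Longrightarrow> col g = col h"
    using finite_coloring_nat by metis
  have "\<bar>f (a \<otimes> g \<otimes> b) - f (a \<otimes> h \<otimes> b)\<bar> \<le> \<epsilon>"
    if gh: "g \<in> carrier G" "h \<in> carrier G" "c' g = c' h" and ab: "a \<in> carrier G" "b \<in> carrier G" for g h a b
  proof -
    obtain k where k: "k \<in> F" "c a = c k" using F(3) ab(1) by (metis imageE imageI)
    have kG: "k \<in> carrier G" using k F by auto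
    have "col g = col h" using c'(2) gh by blast
    then have "c (k \<otimes> g) = c (k \<otimes> h)" unfolding col_def using k(1) by (metis restrict_apply')
    then have "\<bar>f (k \<otimes> g \<otimes> b) - f (k \<otimes> h \<otimes> b)\<bar> \<le> \<epsilon> / 3"
      using gh ab kG by (intro c(2)) auto
    moreover have "\<bar>f (a \<otimes> g \<otimes> b) - f (k \<otimes> g \<otimes> b)\<bar> \<le> \<epsilon> / 3"
      using c(2)[of a k "g \<otimes> b"] gh ab kG k by (simp add: m_assoc)
    moreover have "\<bar>f (a \<otimes> h \<otimes> b) - f (k \<otimes> h \<otimes> b)\<bar> \<le> \<epsilon> / 3"
      using c(2)[of a k "h \<otimes> b"] gh ab kG k by (simp add: m_assoc)
    ultimately show ?thesis by linarith
  qed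
  then show ?thesis using c'(1) by blast
qed

text \<open>The supremum over \<open>a\<close> and \<open>b\<close> of \<open>\<bar>f (a \<otimes> g
  \<otimes> b) - f (a \<otimes> h \<otimes> b)\<bar>\<close> is a bi-invariant, totally bounded
  pseudometric, so the completion is a compact group. As \<open>f\<close> is 1-Lipschitz for it, the
  ball of radius \<open>f \<one> - t\<close> about the identity pulls back into the set.\<close>

lemma (in group) bohr0_set_almost_periodic:
  assumes left: "\<And>\<epsilon>. \<epsilon> > 0 \<Longrightarrow> \<exists>c :: 'a \<Rightarrow> nat. finite (c ` carrier G) \<and>
      (\<forall>g\<in>carrier G. \<forall>h\<in>carrier G. c g = c h \<longrightarrow> (\<forall>b\<in>carrier G. \<bar>f (g \<otimes> b) - f (h \<otimes> b)\<bar> \<le> \<epsilon>))"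
    and "f \<one> > (t::real)"
  shows "bohr0_set G {g \<in> carrier G. f g > t}"
proof -
  \<comment> \<open>A colouring for the error 1 shows that \<open>f\<close> is bounded.\<close>
  obtain c :: "'a \<Rightarrow> nat" where c: "finite (c ` carrier G)"
    "\<And>g h b. \<lbrakk>g \<in> carrier G; h \<in> carrier G; c g = c h; b \<in> carrier G\<rbrakk> \<Longrightarrow> \<bar>f (g \<otimes> b) - f (h \<otimes> b)\<bar> \<le> 1"
    using left[of 1] by auto
  obtain F where F: "F \<subseteq> carrier G" "finite F" "c ` carrier G = c ` F"
    using finite_subset_image[OF c(1) subset_refl] by blast
  define M where "M = 1 + (\<Sum>k\<in>F. \<bar>f k\<bar>)"
  have f_le: "\<bar>f g\<bar> \<le> M" if g: "g \<in> carrier G" for g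
  proof -
    obtain k where k: "k \<in> F" "c g = c k" using F(3) g by (metis imageE imageI)
    then have "\<bar>f (g \<otimes> \<one>) - f (k \<otimes> \<one>)\<bar> \<le> 1" using g F(1) by (intro c(2)) auto
    moreover have "\<bar>f k\<bar> \<le> (\<Sum>k\<in>F. \<bar>f k\<bar>)" using k F(2) by (intro member_le_sum) auto
    moreover have "g \<otimes> \<one> = g" "k \<otimes> \<one> = k" using g k F(1) by auto
    ultimately show ?thesis unfolding M_def by auto
  qed
  have M: "M \<ge> 0" by (simp add: M_def sum_nonneg)
  \<comment> \<open>Every function on a discrete space is continuous, so bounded continuous
    functions on pairs realise the pseudometric as a sup distance in a complete space. The value 0
    off the group adds nothing to distances.\<close>
  define \<phi> :: "'a \<Rightarrow> ('a \<times> 'a) discrete \<Rightarrow> real" where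
    "\<phi> g p = (case of_discrete p of (a, b) \<Rightarrow> if a \<in> carrier G \<and> b \<in> carrier G then f (a \<otimes> g \<otimes> b) else 0)" for g p
  define \<iota> :: "'a \<Rightarrow> ('a \<times> 'a) discrete \<Rightarrow>\<^sub>C real" where "\<iota> g = Bcontfun (\<phi> g)" for g
  have \<iota>_apply: "apply_bcontfun (\<iota> g) = \<phi> g" if "g \<in> carrier G" for g
  proof -
    have "continuous_on UNIV (\<phi> g)" by (simp add: continuous_on_open_vimage open_discrete)
    moreover have "norm (\<phi> g p) \<le> M" for p
      using that f_le M by (auto simp: \<phi>_def split: prod.split)
    ultimately have "\<phi> g \<in> bcontfun" by (rule bcontfun_normI)
    then show ?thesis unfolding \<iota>_def by (rule Bcontfun_inverse)
  qed
  have \<iota>_le: "dist (\<iota> g) (\<iota> h) \<le> e"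
    if "g \<in> carrier G" "h \<in> carrier G" "e \<ge> 0"
      "\<And>a b. \<lbrakk>a \<in> carrier G; b \<in> carrier G\<rbrakk> \<Longrightarrow> \<bar>f (a \<otimes> g \<otimes> b) - f (a \<otimes> h \<otimes> b)\<bar> \<le> e" for g h e
    by (rule dist_bound) (use that in \<open>auto simp: \<iota>_apply \<phi>_def dist_real_def split: prod.split\<close>)
  have \<iota>_ge: "\<bar>f (a \<otimes> g \<otimes> b) - f (a \<otimes> h \<otimes> b)\<bar> \<le> dist (\<iota> g) (\<iota> h)"
    if "g \<in> carrier G" "h \<in> carrier G" "a \<in> carrier G" "b \<in> carrier G" for a b g h
    using dist_bounded[of "\<iota> g" "discrete (a, b)" "\<iota> h"] that
    by (simp add: \<iota>_apply \<phi>_def dist_real_def discrete_inverse)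
  obtain K :: "(('a \<times> 'a) discrete \<Rightarrow>\<^sub>C real) monoid" where
    K: "dense_compact_hom G K (top_of_set (carrier K)) \<iota>" "\<one>\<^bsub>K\<^esub> = \<iota> \<one>"
  proof (rule compact_completion[of \<iota>])
    fix g h g' h' assume gh: "g \<in> carrier G" "h \<in> carrier G" "g' \<in> carrier G" "h' \<in> carrier G"
    show "dist (\<iota> (g \<otimes> h)) (\<iota> (g' \<otimes> h')) \<le> dist (\<iota> g) (\<iota> g') + dist (\<iota> h) (\<iota> h')"
    proof (rule \<iota>_le)
      fix a b assume ab: "a \<in> carrier G" "b \<in> carrier G"
      show "\<bar>f (a \<otimes> (g \<otimes> h) \<otimes> b) - f (a \<otimes> (g' \<otimes> h') \<otimes> b)\<bar> \<le> dist (\<iota> g) (\<iota> g') + dist (\<iota> h) (\<iota> h')"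
        \<comment> \<open>The intermediate product is \<open>g' \<otimes> h\<close>.\<close>
        using \<iota>_ge[of g g' a "h \<otimes> b"] \<iota>_ge[of h h' "a \<otimes> g'" b] gh ab by (simp add: m_assoc)
    qed (use gh in auto)
  next
    fix g h assume gh: "g \<in> carrier G" "h \<in> carrier G"
    show "dist (\<iota> (inv g)) (\<iota> (inv h)) \<le> dist (\<iota> g) (\<iota> h)"
    proof (rule \<iota>_le)
      fix a b assume ab: "a \<in> carrier G" "b \<in> carrier G"
      \<comment> \<open>With \<open>a \<otimes> inv g\<close> on the left and
        \<open>inv h \<otimes> b\<close> on the right, \<open>g\<close> turns into
        \<open>inv h\<close> and \<open>h\<close> into \<open>inv g\<close>.\<close>
      have "g' \<otimes> (inv g' \<otimes> z) = z" "inv g' \<otimes> (g' \<otimes> z) = z" if "g' \<in> carrier G" "z \<in> carrier G" for g' z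
        using that by (simp_all add: m_assoc[symmetric])
      then have "a \<otimes> inv g \<otimes> g \<otimes> (inv h \<otimes> b) = a \<otimes> inv h \<otimes> b"
        "a \<otimes> inv g \<otimes> h \<otimes> (inv h \<otimes> b) = a \<otimes> inv g \<otimes> b"
        using gh ab by (simp_all add: m_assoc)
      then show "\<bar>f (a \<otimes> inv g \<otimes> b) - f (a \<otimes> inv h \<otimes> b)\<bar> \<le> dist (\<iota> g) (\<iota> h)"
        using \<iota>_ge[of g h "a \<otimes> inv g" "inv h \<otimes> b"] gh ab by simp
    qed (use gh in auto)
  next
    fix \<epsilon> :: real assume "\<epsilon> > 0"
    from two_sided_coloring[OF left this] obtain c :: "'a \<Rightarrow> nat" where
      c: "finite (c ` carrier G)" "\<And>g h a b. \<lbrakk>g \<in> carrier G; h \<in> carrier G; c g = c h; a \<in> carrier G; b \<in> carrier G\<rbrakk>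
        \<Longrightarrow> \<bar>f (a \<otimes> g \<otimes> b) - f (a \<otimes> h \<otimes> b)\<bar> \<le> \<epsilon>"
      by blast
    then show "\<exists>c :: 'a \<Rightarrow> nat. finite (c ` carrier G) \<and>
      (\<forall>g\<in>carrier G. \<forall>h\<in>carrier G. c g = c h \<longrightarrow> dist (\<iota> g) (\<iota> h) \<le> \<epsilon>)"
      using \<open>\<epsilon> > 0\<close> by (intro exI[of _ c]) (auto intro!: \<iota>_le)
  qed blast
  show ?thesis
  proof (rule bohr0_setI[OF K(1)])
    show "openin (top_of_set (carrier K)) (carrier K \<inter> ball (\<iota> \<one>) (f \<one> - t))"
      by (rule openin_open_Int) simp
    have "monoid K" using K(1) unfolding dense_compact_hom_def topological_group_def group_def by blast
    then have "\<one>\<^bsub>K\<^esub> \<in> carrier K" by (rule monoid.one_closed)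
    then show "\<one>\<^bsub>K\<^esub> \<in> carrier K \<inter> ball (\<iota> \<one>) (f \<one> - t)" using K(2) assms(2) by simp
    show "\<iota> -` (carrier K \<inter> ball (\<iota> \<one>) (f \<one> - t)) \<inter> carrier G \<subseteq> {g \<in> carrier G. f g > t}"
      using \<iota>_ge[of \<one> _ \<one> \<one>] by force
  qed auto
qed

section \<open>Differences of sets of positive density\<close>

lemma inv_mean_integ:
  fixes G (structure)
  assumes "group G" and m: "m \<in> left_invariant_means G"
  shows "finitely_additive_prob (carrier G) m" "inv_mean G (finitely_additive_prob.integ (carrier G) m)"
proof -
  interpret group G by (rule assms)
  show fa: "finitely_additive_prob (carrier G) m"
    by unfold_locales (use m in \<open>auto simp: left_invariant_means_def\<close>)
  interpret finitely_additive_prob "carrier G" m by (rule fa)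
  show "inv_mean G integ"
  proof
    fix g f assume g: "g \<in> carrier G" and f: "f \<in> bounded_funs (carrier G)"
    show "integ (\<lambda>a. f (g \<otimes> a)) = integ f"
    proof (rule integ_measure_preserving[OF f])
      show "(\<lambda>a. g \<otimes> a) ` carrier G = carrier G"
        using g by (rule surj_const_mult)
      fix X assume X: "X \<subseteq> carrier G"
      have "{x \<in> carrier G. g \<otimes> x \<in> X} = inv g <# X"
      proof safe
        fix x assume "x \<in> carrier G" "g \<otimes> x \<in> X"
        then have "x = inv g \<otimes> (g \<otimes> x)" using g by (simp add: m_assoc[symmetric])
        then show "x \<in> inv g <# X" unfolding l_coset_def using \<open>g \<otimes> x \<in> X\<close> by blast
      qed (use g X in \<open>auto simp: l_coset_def m_assoc[symmetric]\<close>)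
      then show "m {x \<in> carrier G. g \<otimes> x \<in> X} = m X"
        using m g X unfolding left_invariant_means_def by simp
    qed
  qed
qed

theorem theorem1p1:
  fixes G :: "('g, 'm) monoid_scheme" (structure) and A :: "'g set"
  assumes "group G" and "amenable G"
    and "A \<subseteq> carrier G" and "upper_banach_density G A > 0"
  shows "\<exists>B. bohr0_set G B \<and> upper_banach_density G (B - (A <#> (set_inv A))) = 0"
proof -
  interpret group G by (rule assms)
  have ne: "left_invariant_means G \<noteq> {}" using assms(2) by (simp add: amenable_def)
  obtain \<mu> where \<mu>: "\<mu> \<in> left_invariant_means G" "\<mu> A > 0"
  proof (rule ccontr)
    assume "\<not> thesis"
    then have "upper_banach_density G A \<le> 0"
      unfolding upper_banach_density_def using that by (intro cSUP_least[OF ne]) force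
    then show False using assms(4) by simp
  qed
  define J where "J = finitely_additive_prob.integ (carrier G) \<mu>"
  interpret inv_mean G J unfolding J_def using inv_mean_integ(2)[OF assms(1) \<mu>(1)] .
  define v :: "'g \<Rightarrow> real" where "v = indicator A"
  have v1: "\<bar>v a\<bar> \<le> 1" for a by (simp add: v_def indicator_def)
  have Jv: "J v > 0"
    using \<mu>(2) finitely_additive_prob.integ_indicator[OF inv_mean_integ(1)[OF assms(1) \<mu>(1)] assms(3)]
    by (simp add: v_def J_def)
  obtain x where x: "almost_periodic x" "functional (ap_dist v) (\<lambda>y. ip v y - x y)"
    and mixing: "\<And>I. inv_mean G I \<Longrightarrow> I (\<lambda>h. (ip v (orbit v h) - x (orbit v h))\<^sup>2) = 0"
    using almost_periodic_splitting[of v, OF v1] by blast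
  have "x v > 0"
    by (rule projection_pos[OF _ Jv x(2)]) (simp add: v_def indicator_def)
  have vB: "v \<in> bounded_funs (carrier G)" using v1 by (intro bounded_funsI[of _ _ 1])
  obtain D where D: "functional D x" using x(1) unfolding almost_periodic_def by blast
  \<comment> \<open>Any threshold strictly between 0 and \<open>x v\<close> would do:
    \<open>t < f \<one>\<close> makes \<open>U\<close> a Bohr set, and \<open>t > 0\<close> is used
    in the Chebyshev estimate.\<close>
  define t where "t = x v / 2"
  define f where "f h = x (orbit v h)" for h
  define U where "U = {h \<in> carrier G. f h > t}"
  have "bohr0_set G U"
    unfolding U_def
  proof (rule bohr0_set_almost_periodic)
    have "f \<one> = x v"
      unfolding f_def orbit_def by (rule functional_cong[OF D]) (use vB shift_one[of _ v] in simp_all)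
    then show "f \<one> > t" using \<open>x v > 0\<close> by (simp add: t_def)
    fix \<epsilon> :: real assume \<epsilon>: "\<epsilon> > 0"
    obtain c :: "'g \<Rightarrow> nat" where c: "finite (c ` carrier G)"
      "\<And>g h. \<lbrakk>g \<in> carrier G; h \<in> carrier G; c g = c h\<rbrakk> \<Longrightarrow> functional \<epsilon> (\<lambda>y. x (shift g y) - x (shift h y))"
      using almost_periodicE[OF x(1) \<epsilon>] by blast
    \<comment> \<open>Left multiplication in the argument of \<open>f\<close> is a shift by the
      inverse, hence the colouring is composed with inversion.\<close>
    have f_mult: "f (g \<otimes> b) = x (shift (inv g) (orbit v b))" if "g \<in> carrier G" "b \<in> carrier G" for g b
      unfolding f_def orbit_def
      by (rule functional_cong[OF D]) (use that vB shift_shift[of "inv g" "inv b" _ v] in \<open>auto simp: inv_mult_group\<close>)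
    have "\<bar>f (g \<otimes> b) - f (h \<otimes> b)\<bar> \<le> \<epsilon>"
      if "g \<in> carrier G" "h \<in> carrier G" "c (inv g) = c (inv h)" "b \<in> carrier G" for g h b
    proof -
      have ob: "orbit v b \<in> bounded_funs (carrier G)" and n1: "nrm (orbit v b) \<le> 1"
        using that vB v1 by (auto simp: orbit_def intro!: nrm_le_1)
      have "functional \<epsilon> (\<lambda>y. x (shift (inv g) y) - x (shift (inv h) y))"
        using that by (intro c(2)) auto
      from functional_bound[OF this ob]
      have "\<bar>f (g \<otimes> b) - f (h \<otimes> b)\<bar> \<le> \<epsilon> * nrm (orbit v b)"
        using that by (simp add: f_mult)
      also have "\<dots> \<le> \<epsilon> * 1" using n1 \<epsilon> by (intro mult_left_mono) auto
      finally show ?thesis by simp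
    qed
    moreover have "finite ((\<lambda>g. c (inv g)) ` carrier G)"
      by (rule finite_subset[OF _ c(1)]) auto
    ultimately show "\<exists>c :: 'g \<Rightarrow> nat. finite (c ` carrier G) \<and>
        (\<forall>g\<in>carrier G. \<forall>h\<in>carrier G. c g = c h \<longrightarrow> (\<forall>b\<in>carrier G. \<bar>f (g \<otimes> b) - f (h \<otimes> b)\<bar> \<le> \<epsilon>))"
      by blast
  qed
  moreover have "upper_banach_density G (U - (A <#> set_inv A)) = 0"
  proof -
    let ?C = "U - (A <#> set_inv A)"
    have C: "?C \<subseteq> carrier G" by (auto simp: U_def)
    \<comment> \<open>For \<open>h\<close> outside the difference set, \<open>A\<close> and its
      translate by \<open>h\<close> are disjoint.\<close>
    have ip_0: "ip v (orbit v h) = 0" if h: "h \<in> ?C" for h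
    proof -
      have hG: "h \<in> carrier G" using h C by blast
      have "v a * orbit v h a = 0" if a: "a \<in> carrier G" for a
      proof (rule ccontr)
        assume "v a * orbit v h a \<noteq> 0"
        then have "a \<in> A" "inv h \<otimes> a \<in> A"
          by (auto simp: v_def orbit_def shift_def indicator_def split: if_splits)
        moreover have "h = a \<otimes> inv (inv h \<otimes> a)"
          using hG a by (simp add: inv_mult_group m_assoc[symmetric])
        ultimately have "h \<in> A <#> set_inv A"
          unfolding set_mult_def SET_INV_def by blast
        then show False using h by simp
      qed
      then have "ip v (orbit v h) = J (\<lambda>_. 0)"
        unfolding ip_def by (intro J_cong bounded_funs_mult vB) (auto simp: orbit_def hG vB)
      then show ?thesis by (simp add: J_const)
    qed
    \<comment> \<open>The splitting was formed with \<open>\<mu>\<close>, whereas \<open>m\<close>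
      is an arbitrary invariant mean; \<open>mixing\<close> covers all of them.\<close>
    have "m ?C = 0" if m: "m \<in> left_invariant_means G" for m
    proof -
      interpret m: finitely_additive_prob "carrier G" m using inv_mean_integ(1)[OF assms(1) m] .
      note I = inv_mean_integ(2)[OF assms(1) m]
      let ?w = "\<lambda>h. ip v (orbit v h) - x (orbit v h)"
      \<comment> \<open>Chebyshev's inequality: on \<open>?C\<close> the inner product vanishes, so
        \<open>?w h\<close> is \<open>- x (orbit v h)\<close>, of absolute value at least
        \<open>t\<close>.\<close>
      have "t\<^sup>2 * m ?C = m.integ (\<lambda>h. t\<^sup>2 * indicator ?C h)"
        by (subst m.J_scale)
           (auto simp: m.integ_indicator[OF C] indicator_def intro: bounded_funsI[of _ _ 1])
      also have "\<dots> \<le> m.integ (\<lambda>h. (?w h)\<^sup>2)"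
      proof (rule m.J_mono)
        show "(\<lambda>h. t\<^sup>2 * indicator ?C h) \<in> bounded_funs (carrier G)"
          by (intro bounded_funs_scale bounded_funsI[of _ _ 1]) (auto simp: indicator_def)
        show "(\<lambda>h. (?w h)\<^sup>2) \<in> bounded_funs (carrier G)"
          unfolding power2_eq_square by (intro bounded_funs_mult functional_orbit_bounded[OF I v1 x(2)])
        fix h assume "h \<in> carrier G"
        show "t\<^sup>2 * indicator ?C h \<le> (?w h)\<^sup>2"
        proof (cases "h \<in> ?C")
          case True
          then have "t \<le> x (orbit v h)" by (auto simp: U_def f_def)
          then have "t\<^sup>2 \<le> (x (orbit v h))\<^sup>2"
            using \<open>x v > 0\<close> by (intro power_mono) (auto simp: t_def)
          then show ?thesis using ip_0[OF True] True by simp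
        qed simp
      qed
      also have "\<dots> = 0" by (rule mixing[OF I])
      finally have "m ?C \<le> 0" using \<open>x v > 0\<close> by (simp add: t_def mult_le_0_iff)
      moreover have "m ?C \<ge> 0" using m.m_range C by (auto simp: Pi_iff)
      ultimately show ?thesis by simp
    qed
    then have "upper_banach_density G ?C = (SUP m\<in>left_invariant_means G. 0)"
      unfolding upper_banach_density_def by (intro SUP_cong) auto
    then show ?thesis using ne by simp
  qed
  ultimately show ?thesis by blast
qed

end
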